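(* Let $p$ be an odd prime, $d$ a positive odd integer, $h\in\mathbb{Z}$, $q\in\mathbb{C}_p$ with $|1-q|_p<p^{-1/(p-1)}$, $\xi$ an $r$-th root of unity with $(r,pd)=1$ and $|1-\xi|_p\ge1$, and $\chi$ a Dirichlet character of conductor $d$. Define, for $s\in\mathbb{Z}_p$, $$l^{(h)}_{p,q,\xi}(s,\chi)=\int_{\mathbb{X}^*}\chi(t)\langle t\rangle_q^{-s}q^{(h-1)t}\xi^t\,d\mu_{-q}(t).$$ Then for every integer $n\ge0$, $$l^{(h)}_{p,q,\xi}(-n,\chi)=E^{(h)}_{n,q,\xi,\chi_n}-\chi_n(p)\,[p]_q^n\,\frac{[2]_q}{[2]_{q^p}}\,E^{(h)}_{n,q^p,\xi^p,\chi_n}.$$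
   Context: $\mathbb{C}_p$ is the completion of an algebraic closure of $\mathbb{Q}_p$. $\mathbb{X}=\varprojlim_N\mathbb{Z}/dp^N\mathbb{Z}$, $a+dp^N\mathbb{Z}_p=\{x\in\mathbb{X}:x\equiv a\pmod{dp^N}\}$, and $\mathbb{X}^*=\bigcup_{0<a<dp,\,(a,p)=1}(a+dp\mathbb{Z}_p)$. $q^x=\exp(x\log q)$, $[x]_q=\frac{1-q^x}{1-q}$, $[2]_q=1+q$, $[x]_{-q}=\frac{1-(-q)^x}{1+q}$. The fermionic $p$-adic $q$-integral is $\int_{\mathbb{X}}f(t)\,d\mu_{-q}(t)=\lim_{N\to\infty}\frac{1}{[dp^N]_{-q}}\sum_{a=0}^{dp^N-1}f(a)(-q)^a$, and $\int_{\mathbb{X}^*}f\,d\mu_{-q}=\int_{\mathbb{X}}f\cdot\mathbf 1_{\mathbb{X}^*}\,d\mu_{-q}$. $\omega$ is the Teichmüller character mod $p$; for $t\in\mathbb{X}^*$, $\langle t\rangle_q=[t]_q/\omega(t)$, and $\langle t\rangle_q^{-s}=\exp(-s\log_p\langle t\rangle_q)$ with $\log_p$ the Iwasawa $p$-adic logarithm. For an integer $n$, $\chi_n=\chi\omega^{-n}$ (product of characters). For a Dirichlet character $\psi$ whose modulus divides $dp$ and $w\in\mathbb{C}_p$, the generalized twisted $(h,q)$-Euler numbers are $E^{(h)}_{n,q,w,\psi}=\int_{\mathbb{X}}\psi(t)q^{(h-1)t}w^t[t]_q^n\,d\mu_{-q}(t)$ (and $E^{(h)}_{n,q^p,\xi^p,\psi}$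 is the same with $q,w$ replaced by $q^p,\xi^p$).
   Formalization: The two integrals defining the Euler numbers on the right are assumed to exist, since these limits can diverge (e.g. p=3, d=1, χ=1, q=1, n=h=0, ξ=i); existence of the integral defining l(-n,χ) is then proved along with the formula. *)

theory Defs
  imports
    "HOL-Analysis.Analysis"
    "HOL-Computational_Algebra.Primes"
    "HOL-Computational_Algebra.Polynomial"
begin

section \<open>The field of p-adic complex numbers\<close>

text \<open>
  The library has no p-adic fields. The field is therefore a type of sort
  \<^emph>\<open>field_char_0\<close> and \<^emph>\<open>complete_space\<close>, whose metric comes from the absolute value
  \<^emph>\<open>pabs\<close>, and the predicate \<^emph>\<open>is_Cp\<close> below says that this type is a completion of an
  algebraic closure of the p-adic numbers. (The classes of normed fields in the library are
  algebras over the reals and do not apply.)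
\<close>

definition pabs :: "'a::{field_char_0,complete_space} \<Rightarrow> real"
  where "pabs x = dist x 0"

text \<open>In a complete field whose absolute value extends the p-adic one on the rationals,
  the closure of the rationals is their p-adic completion.\<close>

definition Qp :: "'a::{field_char_0,complete_space} set"
  where "Qp = closure \<rat>"

definition Qp_alg :: "'a::{field_char_0,complete_space} set"
  where "Qp_alg = {x. \<exists>f. f \<noteq> 0 \<and> (\<forall>i. coeff f i \<in> Qp) \<and> poly f x = 0}"

definition is_Cp :: "nat \<Rightarrow> 'a::{field_char_0,complete_space} itself \<Rightarrow> bool"
  where "is_Cp p _ \<longleftrightarrow>
    (\<forall>x y :: 'a. dist x y = pabs (x - y)) \<and>
    (\<forall>x y :: 'a. pabs (x * y) = pabs x * pabs y) \<and>
    (\<forall>x y :: 'a. pabs (x + y) \<le> max (pabs x) (pabs y)) \<and>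
    (\<forall>k :: int. k \<noteq> 0 \<longrightarrow> pabs (of_int k :: 'a) = (1 / real p) ^ multiplicity (int p) k) \<and>
    (\<forall>f :: 'a poly. degree f > 0 \<and> (\<forall>i. coeff f i \<in> Qp_alg) \<longrightarrow> (\<exists>x\<in>Qp_alg. poly f x = 0)) \<and>
    closure (Qp_alg :: 'a set) = UNIV"

section \<open>Exponential, logarithm, powers, q-numbers\<close>

definition padic_exp :: "'a::{field_char_0,complete_space} \<Rightarrow> 'a"
  where "padic_exp x = (\<Sum>n. x ^ n / fact n)"

definition padic_log1p :: "'a::{field_char_0,complete_space} \<Rightarrow> 'a"
  where "padic_log1p x = (\<Sum>n. (- 1) ^ n * x ^ Suc n / of_nat (Suc n))"

text \<open>
  The Iwasawa logarithm: the extension of the logarithm series from the open unit ball around 1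
  to a homomorphism on all nonzero elements with the value 0 at p. Each nonzero x has a power
  \<open>x ^ m = p powi k * u\<close> with \<open>m > 0\<close> and \<open>u\<close> in that ball, which forces the value at x.
\<close>

definition iwasawa_log :: "nat \<Rightarrow> 'a::{field_char_0,complete_space} \<Rightarrow> 'a"
  where "iwasawa_log p x = (THE y. \<exists>m>0. \<exists>(k::int) u.
    x ^ m = of_nat p powi k * u \<and> pabs (u - 1) < 1 \<and> y = padic_log1p (u - 1) / of_nat m)"

definition qpow :: "nat \<Rightarrow> 'a::{field_char_0,complete_space} \<Rightarrow> 'a \<Rightarrow> 'a"
  where "qpow p q x = padic_exp (x * iwasawa_log p q)"

text \<open>At \<open>q = 1\<close>, where the quotient is undefined, the value is its limit \<open>x\<close>.\<close>

definition qnum :: "nat \<Rightarrow> 'a::{field_char_0,complete_space} \<Rightarrow> 'a \<Rightarrow> 'a"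
  where "qnum p q x = (if q = 1 then x else (1 - qpow p q x) / (1 - q))"

definition qnum_neg :: "'a::{field_char_0,complete_space} \<Rightarrow> nat \<Rightarrow> 'a"
  where "qnum_neg q k = (1 - (- q) ^ k) / (1 + q)"

section \<open>The space X\<close>

text \<open>An element of the inverse limit is the sequence of its least nonnegative residues
  modulo \<open>d * p ^ N\<close>.\<close>

definition X_space :: "nat \<Rightarrow> nat \<Rightarrow> (nat \<Rightarrow> nat) set"
  where "X_space d p = {t. \<forall>N. t N < d * p ^ N \<and> t (Suc N) mod (d * p ^ N) = t N}"

definition X_ball :: "nat \<Rightarrow> nat \<Rightarrow> nat \<Rightarrow> nat \<Rightarrow> (nat \<Rightarrow> nat) set"
  where "X_ball d p a N = {t \<in> X_space d p. t N = a mod (d * p ^ N)}"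

definition X_star :: "nat \<Rightarrow> nat \<Rightarrow> (nat \<Rightarrow> nat) set"
  where "X_star d p = (\<Union>a\<in>{a. 0 < a \<and> a < d * p \<and> coprime a p}. X_ball d p a 1)"

definition X_nat :: "nat \<Rightarrow> nat \<Rightarrow> nat \<Rightarrow> (nat \<Rightarrow> nat)"
  where "X_nat d p a = (\<lambda>N. a mod (d * p ^ N))"

text \<open>The projection of X to the p-adic integers, inside the field.\<close>

definition X_padic :: "(nat \<Rightarrow> nat) \<Rightarrow> 'a::{field_char_0,complete_space}"
  where "X_padic t = lim (\<lambda>N. of_nat (t N))"

text \<open>
  The power \<open>w ^ t\<close> as the limit of the powers with the residues of \<open>t\<close> as exponents. It is the
  ordinary power if \<open>t\<close> is a natural number (see \<open>X_pow_X_nat\<close>), and the continuous extension in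
  \<open>t\<close> when \<open>w\<close> is close to 1; for other \<open>w\<close> the limit need not exist if \<open>t\<close> is not a natural number.
\<close>

definition X_pow :: "'a::{field_char_0,complete_space} \<Rightarrow> (nat \<Rightarrow> nat) \<Rightarrow> 'a"
  where "X_pow w t = lim (\<lambda>N. w ^ t N)"

text \<open>A function on the integers that is periodic modulo a divisor of \<open>d * p\<close>, read on X.\<close>

definition X_char :: "(nat \<Rightarrow> 'a::{field_char_0,complete_space}) \<Rightarrow> (nat \<Rightarrow> nat) \<Rightarrow> 'a"
  where "X_char \<psi> t = \<psi> (t 1)"

lemma X_nat_in_X_space:
  assumes "d > 0" "p > 0"
  shows "X_nat d p a \<in> X_space d p"
  using assms by (simp add: X_space_def X_nat_def mod_mod_cancel)

lemma X_nat_eventually: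
  assumes "d > 0" "p > 1"
  shows "eventually (\<lambda>N. X_nat d p a N = a) sequentially"
proof (rule eventually_sequentiallyI[of a])
  fix N assume "a \<le> N"
  also have "N < p ^ N" using assms by (simp add: power_gt_expt)
  also have "p ^ N \<le> d * p ^ N" using assms by simp
  finally show "X_nat d p a N = a" by (simp add: X_nat_def)
qed

lemma X_pow_X_nat:
  assumes "d > 0" "p > 1"
  shows "X_pow w (X_nat d p a) = w ^ a"
  unfolding X_pow_def
  by (rule limI, rule tendsto_eventually)
     (use X_nat_eventually[OF assms, of a] in \<open>auto elim: eventually_mono\<close>)

lemma X_padic_X_nat:
  assumes "d > 0" "p > 1"
  shows "X_padic (X_nat d p a) = of_nat a"
  unfolding X_padic_def
  by (rule limI, rule tendsto_eventually)
     (use X_nat_eventually[OF assms, of a] in \<open>auto elim: eventually_mono\<close>)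

section \<open>The fermionic p-adic q-integral\<close>

definition fermionic_sum ::
    "nat \<Rightarrow> nat \<Rightarrow> 'a::{field_char_0,complete_space} \<Rightarrow> ((nat \<Rightarrow> nat) \<Rightarrow> 'a) \<Rightarrow> nat \<Rightarrow> 'a"
  where "fermionic_sum d p q f N =
    1 / qnum_neg q (d * p ^ N) * (\<Sum>a<d * p ^ N. f (X_nat d p a) * (- q) ^ a)"

definition fermionic_integrable ::
    "nat \<Rightarrow> nat \<Rightarrow> 'a::{field_char_0,complete_space} \<Rightarrow> ((nat \<Rightarrow> nat) \<Rightarrow> 'a) \<Rightarrow> bool"
  where "fermionic_integrable d p q f \<longleftrightarrow> convergent (fermionic_sum d p q f)"

definition fermionic_integral ::
    "nat \<Rightarrow> nat \<Rightarrow> 'a::{field_char_0,complete_space} \<Rightarrow> ((nat \<Rightarrow> nat) \<Rightarrow> 'a) \<Rightarrow> 'a"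
  where "fermionic_integral d p q f = lim (fermionic_sum d p q f)"

definition restrict_X_star ::
    "nat \<Rightarrow> nat \<Rightarrow> ((nat \<Rightarrow> nat) \<Rightarrow> 'a::{field_char_0,complete_space}) \<Rightarrow> (nat \<Rightarrow> nat) \<Rightarrow> 'a"
  where "restrict_X_star d p f t = f t * indicator (X_star d p) t"

section \<open>Dirichlet characters\<close>

definition dirichlet_char :: "nat \<Rightarrow> (nat \<Rightarrow> 'a::field) \<Rightarrow> bool"
  where "dirichlet_char m chi \<longleftrightarrow> m > 0 \<and> chi 1 = 1 \<and>
    (\<forall>a b. chi (a * b) = chi a * chi b) \<and> (\<forall>a. chi (a + m) = chi a) \<and>
    (\<forall>a. chi a = 0 \<longleftrightarrow> \<not> coprime a m)"

text \<open>A Dirichlet character modulo its conductor \<open>m\<close>.\<close>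

definition primitive_char :: "nat \<Rightarrow> (nat \<Rightarrow> 'a::field) \<Rightarrow> bool"
  where "primitive_char m chi \<longleftrightarrow> dirichlet_char m chi \<and>
    \<not> (\<exists>k \<psi>. k dvd m \<and> k < m \<and> dirichlet_char k \<psi> \<and> (\<forall>a. coprime a m \<longrightarrow> chi a = \<psi> a))"

definition teichmueller :: "nat \<Rightarrow> nat \<Rightarrow> 'a::{field_char_0,complete_space}"
  where "teichmueller p a =
    (if p dvd a then 0 else (THE z. z ^ (p - 1) = 1 \<and> pabs (z - of_nat a) < 1))"

text \<open>
  The product of \<open>chi\<close> (modulo \<open>d\<close>) with the power \<open>-n\<close> of the Teichmueller character, as a product
  of characters: the primitive character that agrees with the pointwise product at the integers
  prime to \<open>d * p\<close>. Its value at \<open>p\<close> can be nonzero, whereas the pointwise product modulo \<open>d * p\<close>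
  always vanishes there.
\<close>

definition char_twist ::
    "nat \<Rightarrow> nat \<Rightarrow> (nat \<Rightarrow> 'a::{field_char_0,complete_space}) \<Rightarrow> int \<Rightarrow> nat \<Rightarrow> 'a"
  where "char_twist p d chi n = (THE \<psi>. (\<exists>m. primitive_char m \<psi>) \<and>
    (\<forall>a. coprime a (d * p) \<longrightarrow> \<psi> a = chi a * teichmueller p a powi (- n)))"

section \<open>Euler numbers and the l-function\<close>

definition euler_integrand ::
    "nat \<Rightarrow> int \<Rightarrow> nat \<Rightarrow> 'a::{field_char_0,complete_space} \<Rightarrow> 'a \<Rightarrow> (nat \<Rightarrow> 'a) \<Rightarrow> (nat \<Rightarrow> nat) \<Rightarrow> 'a"
  where "euler_integrand p h n q w \<psi> t =
    X_char \<psi> t * qpow p q (of_int (h - 1) * X_padic t) * X_pow w t * qnum p q (X_padic t) ^ n"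

definition euler_number ::
    "nat \<Rightarrow> nat \<Rightarrow> int \<Rightarrow> nat \<Rightarrow> 'a::{field_char_0,complete_space} \<Rightarrow> 'a \<Rightarrow> (nat \<Rightarrow> 'a) \<Rightarrow> 'a"
  where "euler_number p d h n q w \<psi> = fermionic_integral d p q (euler_integrand p h n q w \<psi>)"

definition qangle :: "nat \<Rightarrow> 'a::{field_char_0,complete_space} \<Rightarrow> (nat \<Rightarrow> nat) \<Rightarrow> 'a"
  where "qangle p q t = qnum p q (X_padic t) / X_char (teichmueller p) t"

definition qangle_pow :: "nat \<Rightarrow> 'a::{field_char_0,complete_space} \<Rightarrow> (nat \<Rightarrow> nat) \<Rightarrow> 'a \<Rightarrow> 'a"
  where "qangle_pow p q t s = padic_exp (s * iwasawa_log p (qangle p q t))"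

text \<open>The variable \<open>s\<close> is meant to be a p-adic integer, an element of \<open>closure \<int>\<close>.\<close>

definition l_integrand ::
    "nat \<Rightarrow> nat \<Rightarrow> int \<Rightarrow> 'a::{field_char_0,complete_space} \<Rightarrow> 'a \<Rightarrow> 'a \<Rightarrow> (nat \<Rightarrow> 'a) \<Rightarrow> (nat \<Rightarrow> nat) \<Rightarrow> 'a"
  where "l_integrand p d h q \<xi> s chi = restrict_X_star d p
    (\<lambda>t. X_char chi t * qangle_pow p q t (- s) * qpow p q (of_int (h - 1) * X_padic t) * X_pow \<xi> t)"

definition l_function ::
    "nat \<Rightarrow> nat \<Rightarrow> int \<Rightarrow> 'a::{field_char_0,complete_space} \<Rightarrow> 'a \<Rightarrow> 'a \<Rightarrow> (nat \<Rightarrow> 'a) \<Rightarrow> 'a"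
  where "l_function p d h q \<xi> s chi = fermionic_integral d p q (l_integrand p d h q \<xi> s chi)"

end

theory Submission
  imports Defs "HOL-Number_Theory.Residues"
begin

text \<open>
  On the small ball around 1 the p-adic exponential inverts the logarithm, so that
  \<open>\<langle>a\<rangle>\<^sub>q ^ n = [a]\<^sub>q ^ n * \<omega>(a) ^ (-n)\<close> for each natural number \<open>a\<close> prime to \<open>p\<close>. Because \<open>\<chi>\<close> is
  primitive, the primitive character \<open>\<chi>\<^sub>n\<close> agrees with \<open>\<chi> \<omega> ^ (-n)\<close> at all such \<open>a\<close>, including those
  that are not prime to \<open>d\<close>. Hence the Riemann sum of the l-function at level \<open>N + 1\<close> is the
  Riemann sum of the first Euler number without the terms at multiples of \<open>p\<close>. Since \<open>p\<close> is odd,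
  \<open>[p b]\<^sub>q = [p]\<^sub>q [b]\<^bsub>q'\<^esub>\<close> and \<open>(-q) ^ (p b) = (-q') ^ b\<close> with \<open>q' = q ^ p\<close>, so these terms form
  exactly the Riemann sum of the second Euler number at level \<open>N\<close>, up to the constant factor.
\<close>

section \<open>Primitive Dirichlet characters\<close>

text \<open>The integral samples its integrand only at natural numbers, where \<open>X_pow\<close>,
  \<open>X_padic\<close> and \<open>qpow\<close> reduce to ordinary values and powers. The identity
  between Riemann sums is therefore exact at each finite level, and a limit is taken only once, from
  the assumed convergence of the two Euler sums. The analytic obstacle is that powers of
  \<open>qangle\<close> combine two series with different discs: the logarithm converges on the open
  unit disc around 1, the exponential for |x| < \<open>rho\<close> = p^(-1/(p-1)). Two estimates put
  [a]_q/\<omega>(a) into the smaller disc around 1: |[a]_q - a| \<le> |q - 1| < \<open>rho\<close>,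
  which is the role of the bound on q, and |\<omega>(a) - a| \<le> 1/p < \<open>rho\<close>, where
  the strict inequality uses p > 2. To avoid composing power series, the logarithm is handled as the
  limit of (u^(p^N) - 1)/p^N; its functional equation, |log u| = |u - 1| for |u - 1| <
  \<open>rho\<close>, and log(exp y) = y then follow from elementary estimates.\<close>

lemma coprime_cong_exists:
  fixes a k M :: nat
  assumes "coprime a k" and "M > 0"
  obtains b where "[b = a] (mod k)" and "coprime b M"
proof
  \<comment> \<open>Each prime l dividing \<open>M\<close> divides exactly one of \<open>a\<close>
    and \<open>k * t\<close>: if l divides \<open>a\<close>, it divides neither \<open>k\<close> nor
    \<open>t\<close>; otherwise it is a factor of \<open>t\<close>. Hence no such l divides the
    sum.\<close>
  define t where "t = \<Prod>{l. prime l \<and> l dvd M \<and> \<not> l dvd a}"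
  have fin: "finite {l. prime l \<and> l dvd M \<and> \<not> l dvd a}"
    by (rule finite_subset[of _ "{..M}"]) (use assms(2) dvd_imp_le in auto)
  show "[a + k * t = a] (mod k)"
    by (simp add: cong_def)
  show "coprime (a + k * t) M"
  proof (rule ccontr)
    assume "\<not> coprime (a + k * t) M"
    then have "gcd (a + k * t) M \<noteq> 1"
      by (simp only: coprime_iff_gcd_eq_1 not_False_eq_True)
    then obtain l where l: "prime l" "l dvd a + k * t" "l dvd M"
      using prime_factor_nat by (auto simp del: gcd_greatest_iff dest!: gcd_nat.boundedE)
    show False
    proof (cases "l dvd a")
      case True
      then have "l dvd k * t"
        using l(2) dvd_add_right_iff by blast
      moreover have "\<not> l dvd k"
        using True assms(1) l(1) by (meson coprime_common_divisor not_prime_unit)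
      ultimately have "l dvd t"
        using l(1) prime_dvd_mult_iff by blast
      then obtain x where "x \<in> {l. prime l \<and> l dvd M \<and> \<not> l dvd a}" "l dvd x"
        unfolding t_def using prime_dvd_prod_iff[OF fin l(1)] by auto
      then show False
        using True l(1) primes_dvd_imp_eq by blast
    next
      case False
      then have "l dvd t"
        unfolding t_def using l fin by (intro dvd_prodI[where f = "\<lambda>x. x", simplified]) auto
      then have "l dvd a"
        using l(2) by (metis dvd_add_left_iff dvd_mult)
      then show False using False by blast
    qed
  qed
qed

lemma cong_gcd_solution:
  fixes a b m k :: nat
  assumes "[a = b] (mod gcd m k)" and "k > 0"
  obtains c where "[c = a] (mod m)" and "[c = b] (mod k)"
proof -
  \<comment> \<open>\<open>b\<close> is raised by a multiple of both \<open>gcd m k\<close> and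
    \<open>k\<close>, which preserves the congruences and makes \<open>b' - a\<close> a genuine
    difference of natural numbers.\<close>
  define b' where "b' = b + gcd m k * k * a"
  have "b' \<ge> a"
    unfolding b'_def using assms(2) by (cases "gcd m k * k") auto
  moreover have "[a = b'] (mod gcd m k)"
    using assms(1) by (simp add: b'_def cong_def mult.assoc)
  ultimately have "gcd m k dvd b' - a"
    by (metis cong_altdef_nat cong_sym)
  then obtain t where t: "b' - a = gcd m k * t" ..
  obtain x where x: "[m * x = gcd m k] (mod k)"
    using cong_solve_nat by blast
  show ?thesis
  proof
    show "[a + m * (x * t) = a] (mod m)"
      by (simp add: cong_def)
    have "[m * x * t = gcd m k * t] (mod k)"
      using x by (rule cong_scalar_right)
    then have "[a + m * x * t = a + (b' - a)] (mod k)"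
      unfolding t by (rule cong_add[OF cong_refl])
    then have "[a + m * x * t = b'] (mod k)"
      using \<open>b' \<ge> a\<close> by simp
    moreover have "[b' = b] (mod k)"
      by (simp add: b'_def cong_def mult.commute[of _ k] mult.assoc)
    ultimately show "[a + m * (x * t) = b] (mod k)"
      by (metis cong_trans mult.assoc)
  qed
qed

section \<open>Periodicity, products and powers of Dirichlet characters\<close>

lemma coprime_cong_iff:
  fixes a b m :: nat
  assumes "[a = b] (mod m)"
  shows "coprime a m \<longleftrightarrow> coprime b m"
  using assms by (metis cong_imp_coprime cong_sym)

lemma dirichlet_char_mult: "dirichlet_char m f \<Longrightarrow> f (a * b) = f a * f b"
  and dirichlet_char_eq_0_iff: "dirichlet_char m f \<Longrightarrow> f a = 0 \<longleftrightarrow> \<not> coprime a m"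
  and dirichlet_char_modulus_pos: "dirichlet_char m f \<Longrightarrow> m > 0"
  by (auto simp: dirichlet_char_def)

lemma dirichlet_char_add_mult:
  assumes "dirichlet_char m f"
  shows "f (a + m * k) = f a"
proof (induction k)
  case (Suc k)
  have "f (a + m * Suc k) = f (a + m * k + m)"
    by (simp add: algebra_simps)
  then show ?case
    using assms Suc by (simp add: dirichlet_char_def)
qed simp

lemma dirichlet_char_mod:
  assumes "dirichlet_char m f" and "m dvd k"
  shows "f (a mod k) = f a"
proof -
  obtain j where "k = m * j" using assms(2) ..
  then have "f a = f (a mod k + m * (j * (a div k)))"
    by (metis mod_mult_div_eq mult.assoc)
  then show ?thesis
    by (simp add: dirichlet_char_add_mult[OF assms(1)])
qed

lemma dirichlet_char_cong:
  assumes "dirichlet_char m f" and "[a = b] (mod m)"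
  shows "f a = f b"
  using assms dirichlet_char_mod[OF assms(1) dvd_refl] by (metis cong_def)

lemma dirichlet_char_times:
  assumes f: "dirichlet_char m f" and g: "dirichlet_char k g"
  shows "dirichlet_char (m * k) (\<lambda>a. f a * g a)"
  unfolding dirichlet_char_def
proof (intro conjI allI)
  fix a
  show "f (a + m * k) * g (a + m * k) = f a * g a"
    using dirichlet_char_add_mult[OF f, of a k] dirichlet_char_add_mult[OF g, of a m]
    by (simp add: mult.commute)
qed (use f g in \<open>auto simp: dirichlet_char_def\<close>)

text \<open>The case distinction matters for \<open>n = 0\<close>, where \<open>0 powi 0 = 1\<close>
  would break the vanishing at arguments not prime to \<open>m\<close>.\<close>

lemma dirichlet_char_powi:
  assumes "dirichlet_char m f"
  shows "dirichlet_char m (\<lambda>a. if coprime a m then f a powi n else 0)"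
proof -
  have "coprime (a + m) m \<longleftrightarrow> coprime a m" for a
    by (simp add: coprime_iff_gcd_eq_1)
  then show ?thesis
    using assms unfolding dirichlet_char_def by (auto simp: power_int_mult_distrib)
qed

text \<open>One integer realises the residues \<open>a\<close> modulo \<open>m\<close> and
  \<open>b\<close> modulo \<open>k\<close>, and within its class modulo \<open>m * k\<close> it can
  be chosen prime to \<open>M\<close>, where the characters coincide. In effect both factor through
  \<open>gcd m k\<close> on their units.\<close>

lemma dirichlet_chars_agree:
  assumes f: "dirichlet_char m f" and g: "dirichlet_char k g" and "M > 0"
    and agree: "\<And>a. coprime a M \<Longrightarrow> f a = g a"
    and "coprime a m" and "coprime b k" and "[a = b] (mod gcd m k)"
  shows "f a = g b"
proof -
  have "m > 0" "k > 0"
    using f g by (auto simp: dirichlet_char_def)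
  obtain c where c: "[c = a] (mod m)" "[c = b] (mod k)"
    using cong_gcd_solution[OF assms(7) \<open>k > 0\<close>] by blast
  have "coprime c (m * k)"
    using assms(5,6) c by (simp add: coprime_cong_iff)
  then obtain e where e: "[e = c] (mod (m * k))" "coprime e M"
    using coprime_cong_exists \<open>M > 0\<close> by blast
  have "[e = a] (mod m)" "[e = b] (mod k)"
    using e(1) c by (metis cong_modulus_mult_nat cong_trans, metis cong_modulus_mult_nat cong_trans mult.commute)
  then show ?thesis
    using agree[OF e(2)] dirichlet_char_cong f g by metis
qed

text \<open>Otherwise \<open>f\<close> would be induced from the proper divisor
  \<open>gcd m k\<close> of \<open>m\<close>, since its nonzero values can be read off from
  \<open>g\<close> at a common representative modulo that divisor.\<close>

lemma primitive_char_modulus_dvd: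
  assumes prim: "primitive_char m f" and g: "dirichlet_char k g" and "M > 0"
    and agree: "\<And>a. coprime a M \<Longrightarrow> f a = g a"
  shows "m dvd k"
proof (rule ccontr)
  assume "\<not> m dvd k"
  define e where "e = gcd m k"
  have f: "dirichlet_char m f"
    using prim by (simp add: primitive_char_def)
  note agrees = dirichlet_chars_agree[OF f g \<open>M > 0\<close> agree]
  have pos: "m > 0" "k > 0" "e > 0"
    using f g by (auto simp: dirichlet_char_def e_def)
  have "e dvd m" "e dvd k" "e \<noteq> m"
    using \<open>\<not> m dvd k\<close> by (auto simp: e_def) (metis gcd_dvd2)
  \<comment> \<open>A unit modulo \<open>e\<close> is lifted to an integer prime to both moduli,
    where \<open>f\<close> and \<open>g\<close> are both nonzero. The character \<open>h\<close>
    modulo \<open>e\<close> is \<open>f\<close> along this lift, and \<open>eq\<close> shows that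
    the choice of lift is immaterial.\<close>
  define R where "R a = (SOME b. [b = a] (mod e) \<and> coprime b (m * k))" for a
  have R: "[R a = a] (mod e)" "coprime (R a) m" "coprime (R a) k" if "coprime a e" for a
  proof -
    have "\<exists>b. [b = a] (mod e) \<and> coprime b (m * k)"
      using coprime_cong_exists[OF that, of "m * k"] pos by (metis nat_0_less_mult_iff)
    from someI_ex[OF this] show "[R a = a] (mod e)" "coprime (R a) m" "coprime (R a) k"
      by (auto simp: R_def)
  qed
  have eq: "f a = f b" if "coprime a m" "coprime b m" "[a = b] (mod e)" for a b
  proof -
    have ce: "coprime b e"
      using that(2) \<open>e dvd m\<close> by (metis coprime_divisors dvd_refl)
    have "f a = g (R b)"
      using that R[OF ce] by (intro agrees) (auto simp flip: e_def intro: cong_trans cong_sym)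
    moreover have "f b = g (R b)"
      using that R[OF ce] by (intro agrees) (auto simp flip: e_def intro: cong_sym)
    ultimately show ?thesis by simp
  qed
  define h where "h a = (if coprime a e then f (R a) else 0)" for a
  have h: "h a = f a" if "coprime a m" for a
  proof -
    have "coprime a e"
      using that \<open>e dvd m\<close> by (metis coprime_divisors dvd_refl)
    then show ?thesis
      using eq[of "R a" a] R that by (simp add: h_def)
  qed
  have "dirichlet_char e h"
    unfolding dirichlet_char_def
  proof (intro conjI allI)
    show "e > 0" by (fact pos)
    show "h 1 = 1"
      using h[of 1] f by (simp add: dirichlet_char_def)
    fix a
    show "(h a = 0) = (\<not> coprime a e)"
      using R(2)[of a] dirichlet_char_eq_0_iff[OF f] by (simp add: h_def)
    have ce: "coprime (a + e) e \<longleftrightarrow> coprime a e"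
      by (simp add: coprime_iff_gcd_eq_1)
    have "[R (a + e) = R a] (mod e)" if "coprime a e"
      using R(1)[of a] R(1)[of "a + e"] that ce by (simp add: cong_def)
    then show "h (a + e) = h a"
      using ce R(2) by (auto simp: h_def intro!: eq)
    fix b
    have "[R (a * b) = R a * R b] (mod e)" if "coprime a e" "coprime b e"
      using R(1)[of a] R(1)[of b] R(1)[of "a * b"] that
      by (metis cong_mult cong_sym cong_trans coprime_mult_left_iff)
    then have "f (R (a * b)) = f (R a * R b)" if "coprime a e" "coprime b e"
      using R(2) that by (intro eq) auto
    then show "h (a * b) = h a * h b"
      using dirichlet_char_mult[OF f] by (auto simp: h_def)
  qed
  moreover have "e < m"
    using \<open>e dvd m\<close> \<open>e \<noteq> m\<close> pos(1) dvd_imp_le le_neq_implies_less by blast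
  moreover have "\<forall>a. coprime a m \<longrightarrow> f a = h a"
    using h by simp
  ultimately show False
    using prim \<open>e dvd m\<close> unfolding primitive_char_def by blast
qed

lemma primitive_char_unique:
  assumes f: "primitive_char m f" and g: "primitive_char k g" and "M > 0"
    and agree: "\<And>a. coprime a M \<Longrightarrow> f a = g a"
  shows "f = g"
proof
  fix a
  have f': "dirichlet_char m f" and g': "dirichlet_char k g"
    using f g by (auto simp: primitive_char_def)
  have "m = k"
    using primitive_char_modulus_dvd[OF f g' \<open>M > 0\<close>] primitive_char_modulus_dvd[OF g f' \<open>M > 0\<close>] agree
    by (simp add: dvd_antisym)
  show "f a = g a"
  proof (cases "coprime a m")
    case True
    then show ?thesis
      using dirichlet_chars_agree[OF f' g' \<open>M > 0\<close> agree, of a a] \<open>m = k\<close> by simp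
  next
    case False
    then show ?thesis
      using dirichlet_char_eq_0_iff f' g' \<open>m = k\<close> by metis
  qed
qed

text \<open>The least modulus dividing \<open>M\<close> that carries a character extending
  \<open>f\<close> works: a character of smaller modulus inducing \<open>g\<close> would again agree
  with \<open>f\<close> at the integers prime to \<open>M\<close>, because these are prime to
  \<open>m\<close>.\<close>

lemma primitive_char_exists:
  assumes "dirichlet_char M f"
  obtains m g where "primitive_char m g" and "\<And>a. coprime a M \<Longrightarrow> g a = f a"
proof -
  define P where "P m \<longleftrightarrow> (\<exists>g. dirichlet_char m g \<and> m dvd M \<and> (\<forall>a. coprime a M \<longrightarrow> g a = f a))" for m
  have "P M"
    using assms by (auto simp: P_def)
  then have "P (LEAST m. P m)"
    by (rule LeastI)
  then obtain m g where m: "m = (LEAST m. P m)" and g: "dirichlet_char m g" "m dvd M"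
    "\<And>a. coprime a M \<Longrightarrow> g a = f a"
    by (auto simp: P_def)
  have "\<not> (k dvd m \<and> k < m \<and> dirichlet_char k h \<and> (\<forall>a. coprime a m \<longrightarrow> g a = h a))" for k h
  proof
    assume *: "k dvd m \<and> k < m \<and> dirichlet_char k h \<and> (\<forall>a. coprime a m \<longrightarrow> g a = h a)"
    have "coprime a m" if "coprime a M" for a
      using that g(2) by (metis coprime_divisors dvd_refl)
    then have "P k"
      using * g by (auto simp: P_def intro: dvd_trans)
    then show False
      using * not_less_Least m by blast
  qed
  then have "primitive_char m g"
    using g(1) unfolding primitive_char_def by blast
  then show ?thesis
    using that g(3) by blast
qed

section \<open>Analysis in the p-adic complex numbers\<close>

locale padic_complex =
  fixes p :: nat and T :: "'a::{field_char_0,complete_space} itself"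
  assumes prime_p: "prime p" and odd_p: "odd p" and Cp: "is_Cp p T"
begin

section \<open>Rules for the ultrametric absolute value\<close>

lemma p_ge_3: "p \<ge> 3"
  using prime_p odd_p prime_ge_2_nat[of p] by (cases "p = 2") auto

lemma p_pos [simp]: "p > 0"
  using p_ge_3 by simp

lemma dist_pabs: "dist (x::'a) y = pabs (x - y)"
  and pabs_mult: "pabs ((x::'a) * y) = pabs x * pabs y"
  and pabs_add_le: "pabs ((x::'a) + y) \<le> max (pabs x) (pabs y)"
  and pabs_of_int: "k \<noteq> 0 \<Longrightarrow> pabs (of_int k :: 'a) = (1 / real p) ^ multiplicity (int p) k"
proof -
  note ax = Cp[unfolded is_Cp_def]
  show "dist x y = pabs (x - y)"
    by (rule conjunct1[OF ax, rule_format])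
  note ax = conjunct2[OF ax]
  show "pabs (x * y) = pabs x * pabs y"
    by (rule conjunct1[OF ax, rule_format])
  note ax = conjunct2[OF ax]
  show "pabs (x + y) \<le> max (pabs x) (pabs y)"
    by (rule conjunct1[OF ax, rule_format])
  note ax = conjunct2[OF ax]
  show "k \<noteq> 0 \<Longrightarrow> pabs (of_int k :: 'a) = (1 / real p) ^ multiplicity (int p) k"
    by (rule conjunct1[OF ax, rule_format])
qed

lemma pabs_nonneg [simp]: "pabs (x::'a) \<ge> 0"
  and pabs_eq_0_iff [simp]: "pabs (x::'a) = 0 \<longleftrightarrow> x = 0"
  and pabs_0 [simp]: "pabs (0::'a) = 0"
  by (simp_all add: pabs_def)

lemma pabs_1 [simp]: "pabs (1::'a) = 1"
  using pabs_of_int[of 1] by simp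

lemma pabs_minus [simp]: "pabs (- (x::'a)) = pabs x"
proof -
  have "pabs (-1 :: 'a) ^ 2 = 1"
    by (simp add: power2_eq_square flip: pabs_mult)
  then have "pabs (-1 :: 'a) = 1"
    using pabs_nonneg by (simp add: power2_eq_1_iff order_antisym) (metis pabs_nonneg not_one_le_zero neg_0_le_iff_le)
  then show ?thesis
    using pabs_mult[of "-1" x] by simp
qed

lemma pabs_minus_commute: "pabs ((x::'a) - y) = pabs (y - x)"
  using pabs_minus[of "x - y"] by simp

lemma pabs_diff_le: "pabs ((x::'a) - y) \<le> max (pabs x) (pabs y)"
  using pabs_add_le[of x "- y"] by simp

lemma pabs_add_leI: "pabs (x::'a) \<le> B \<Longrightarrow> pabs y \<le> B \<Longrightarrow> pabs (x + y) \<le> B"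
  and pabs_add_lessI: "pabs x < B \<Longrightarrow> pabs y < B \<Longrightarrow> pabs (x + y) < B"
  and pabs_diff_leI: "pabs x \<le> B \<Longrightarrow> pabs y \<le> B \<Longrightarrow> pabs (x - y) \<le> B"
  and pabs_diff_lessI: "pabs x < B \<Longrightarrow> pabs y < B \<Longrightarrow> pabs (x - y) < B"
  using pabs_add_le[of x y] pabs_diff_le[of x y] by linarith+

lemma pabs_diff_triangle: "pabs ((x::'a) - z) \<le> max (pabs (x - y)) (pabs (y - z))"
  using pabs_add_le[of "x - y" "y - z"] by simp

lemma pabs_power: "pabs ((x::'a) ^ n) = pabs x ^ n"
  by (induction n) (simp_all add: pabs_mult)

lemma pabs_inverse: "pabs (inverse (x::'a)) = inverse (pabs x)"
proof (cases "x = 0")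
  case False
  then have "pabs x * pabs (inverse x) = 1"
    using pabs_mult[of x "inverse x"] by simp
  then show ?thesis
    by (metis inverse_unique)
qed simp

lemma pabs_divide: "pabs ((x::'a) / y) = pabs x / pabs y"
  by (simp add: divide_inverse pabs_mult pabs_inverse)

lemma pabs_power_int: "pabs ((x::'a) powi k) = pabs x powi k"
  by (simp add: power_int_def pabs_power pabs_inverse)

lemma pabs_sum_le:
  fixes f :: "'b \<Rightarrow> 'a"
  assumes "\<And>i. i \<in> A \<Longrightarrow> pabs (f i) \<le> B" and "B \<ge> 0"
  shows "pabs (sum f A) \<le> B"
  using assms(1)
proof (induction A rule: infinite_finite_induct)
  case (insert i A)
  then show ?case
    using order_trans[OF pabs_add_le[of "f i" "sum f A"]] by simp
qed (use assms(2) in auto)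

lemma pabs_add_eq_left:
  assumes "pabs (y::'a) < pabs x"
  shows "pabs (x + y) = pabs x"
  using pabs_add_le[of x y] pabs_diff_le[of "x + y" y] assms by (auto simp: max_def split: if_splits)

lemma pabs_eq_1:
  assumes "pabs ((u::'a) - 1) < 1"
  shows "pabs u = 1"
  using pabs_add_eq_left[of "u - 1" 1] assms by simp

lemma pabs_of_nat_le: "pabs (of_nat k :: 'a) \<le> 1"
proof (induction k)
  case (Suc k)
  then show ?case using pabs_add_le[of 1 "of_nat k"] by simp
qed simp

lemma pabs_of_nat_eq_1:
  assumes "\<not> p dvd k"
  shows "pabs (of_nat k :: 'a) = 1"
proof -
  have "k \<noteq> 0" using assms by (metis dvd_0_right)
  moreover have "multiplicity (int p) (int k) = 0"
    using assms by (intro not_dvd_imp_multiplicity_0) simp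
  ultimately show ?thesis
    using pabs_of_int[of "int k"] by simp
qed

lemma pabs_p: "pabs (of_nat p :: 'a) = 1 / real p"
proof -
  have "multiplicity (int p) (int p) = 1"
    using prime_p by (intro multiplicity_self) (auto simp: prime_gt_1_nat)
  then show ?thesis
    using pabs_of_int[of "int p"] prime_gt_0_nat[OF prime_p] by simp
qed

lemma pabs_of_nat_dvd_le:
  assumes "p dvd k"
  shows "pabs (of_nat k :: 'a) \<le> 1 / real p"
proof -
  obtain j where "k = p * j" using assms ..
  then show ?thesis
    using mult_left_mono[OF pabs_of_nat_le[of j], of "1 / real p"] by (simp add: pabs_mult pabs_p)
qed

text \<open>The power of p dividing \<open>k\<close> is at most \<open>k\<close>. The loss is linear
  in \<open>k\<close>, so geometric decay absorbs the denominators of the logarithm series.\<close>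

lemma pabs_of_nat_ge:
  assumes "k > 0"
  shows "pabs (of_nat k :: 'a) \<ge> 1 / real k"
proof -
  let ?m = "multiplicity (int p) (int k)"
  have "int p ^ ?m dvd int k"
    by (rule multiplicity_dvd)
  then have "p ^ ?m \<le> k"
    using assms by (metis dvd_imp_le int_dvd_int_iff of_nat_power)
  then have "real p ^ ?m \<le> real k"
    by (metis of_nat_le_iff of_nat_power)
  then have "1 / real k \<le> 1 / real p ^ ?m"
    using p_ge_3 assms by (intro divide_left_mono) auto
  then show ?thesis
    using pabs_of_int[of "int k"] assms by (simp add: power_one_over)
qed

subsection \<open>Limits and series\<close>

lemma tendsto_iff_pabs:
  "((X :: 'b \<Rightarrow> 'a) \<longlongrightarrow> L) F \<longleftrightarrow> ((\<lambda>n. pabs (X n - L)) \<longlongrightarrow> 0) F"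
  using tendsto_dist_iff[of X L F] by (simp add: dist_pabs)

lemma tendsto_pabs:
  "((X :: 'b \<Rightarrow> 'a) \<longlongrightarrow> L) F \<Longrightarrow> ((\<lambda>n. pabs (X n)) \<longlongrightarrow> pabs L) F"
  unfolding pabs_def by (intro tendsto_dist tendsto_const)

lemma tendsto_pabs_bound:
  fixes X :: "nat \<Rightarrow> 'a"
  assumes "\<And>n. pabs (X n - L) \<le> g n" and "g \<longlonglongrightarrow> 0"
  shows "X \<longlonglongrightarrow> L"
  unfolding tendsto_iff_pabs
  by (rule Lim_null_comparison[OF _ assms(2)]) (use assms(1) in simp)

text \<open>The sort of the type gives a metric but does not relate it to the field operations, so
  their continuity is derived from the absolute value.\<close>

lemma tendsto_padic_add:
  fixes X Y :: "nat \<Rightarrow> 'a"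
  assumes "X \<longlonglongrightarrow> L" "Y \<longlonglongrightarrow> M"
  shows "(\<lambda>n. X n + Y n) \<longlonglongrightarrow> L + M"
proof (rule tendsto_pabs_bound)
  fix n
  have "pabs (X n + Y n - (L + M)) = pabs ((X n - L) + (Y n - M))"
    by (simp add: algebra_simps)
  also have "\<dots> \<le> max (pabs (X n - L)) (pabs (Y n - M))"
    by (rule pabs_add_le)
  also have "\<dots> \<le> pabs (X n - L) + pabs (Y n - M)"
    by (simp add: max_def)
  finally show "pabs (X n + Y n - (L + M)) \<le> pabs (X n - L) + pabs (Y n - M)" .
next
  show "(\<lambda>n. pabs (X n - L) + pabs (Y n - M)) \<longlonglongrightarrow> 0"
    using tendsto_add[of "\<lambda>n. pabs (X n - L)" 0 _ "\<lambda>n. pabs (Y n - M)" 0] assms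
    by (simp add: tendsto_iff_pabs)
qed

lemma tendsto_padic_cmult:
  fixes X :: "nat \<Rightarrow> 'a"
  assumes "X \<longlonglongrightarrow> L"
  shows "(\<lambda>n. c * X n) \<longlonglongrightarrow> c * L"
proof (rule tendsto_pabs_bound)
  show "pabs (c * X n - c * L) \<le> pabs c * pabs (X n - L)" for n
    by (simp flip: right_diff_distrib add: pabs_mult)
  show "(\<lambda>n. pabs c * pabs (X n - L)) \<longlonglongrightarrow> 0"
    using tendsto_mult_right_zero[of "\<lambda>n. pabs (X n - L)"] assms by (simp add: tendsto_iff_pabs)
qed

lemma tendsto_padic_diff:
  fixes X Y :: "nat \<Rightarrow> 'a"
  assumes "X \<longlonglongrightarrow> L" "Y \<longlonglongrightarrow> M"
  shows "(\<lambda>n. X n - Y n) \<longlonglongrightarrow> L - M"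
  using tendsto_padic_add[OF assms(1) tendsto_padic_cmult[OF assms(2), of "-1"]] by simp

lemma tendsto_padic_mult:
  fixes X Y :: "nat \<Rightarrow> 'a"
  assumes X: "X \<longlonglongrightarrow> L" and Y: "Y \<longlonglongrightarrow> M"
  shows "(\<lambda>n. X n * Y n) \<longlonglongrightarrow> L * M"
proof -
  have "(\<lambda>n. pabs (X n - L) * pabs (Y n)) \<longlonglongrightarrow> 0 * pabs M"
    using X Y by (intro tendsto_mult tendsto_pabs) (simp add: tendsto_iff_pabs)
  then have "(\<lambda>n. (X n - L) * Y n) \<longlonglongrightarrow> 0"
    by (simp add: tendsto_iff_pabs pabs_mult)
  from tendsto_padic_add[OF this tendsto_padic_cmult[OF Y, of L]] show ?thesis
    by (simp add: algebra_simps)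
qed

lemma tendsto_padic_power:
  fixes X :: "nat \<Rightarrow> 'a"
  assumes "X \<longlonglongrightarrow> L"
  shows "(\<lambda>n. X n ^ k) \<longlonglongrightarrow> L ^ k"
  using assms by (induction k) (auto intro: tendsto_padic_mult)

lemma pabs_tendsto_le:
  fixes X :: "nat \<Rightarrow> 'a"
  assumes "X \<longlonglongrightarrow> L" and "\<And>n. n \<ge> N \<Longrightarrow> pabs (X n - c) \<le> B"
  shows "pabs (L - c) \<le> B"
  using tendsto_pabs[OF tendsto_padic_diff[OF assms(1) tendsto_const[of c]]] assms(2)
  by (intro LIMSEQ_le_const2) auto

text \<open>In an ultrametric the distance between two members is at most the largest step between
  them, so null steps already give a Cauchy sequence.\<close>

lemma convergent_of_differences:
  fixes X :: "nat \<Rightarrow> 'a"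
  assumes "(\<lambda>n. X (Suc n) - X n) \<longlonglongrightarrow> 0"
  shows "convergent X"
proof -
  have "Cauchy X"
  proof (rule metric_CauchyI)
    fix e :: real assume "e > 0"
    have "(\<lambda>n. pabs (X (Suc n) - X n)) \<longlonglongrightarrow> 0"
      using assms by (simp add: tendsto_iff_pabs)
    then have "eventually (\<lambda>n. pabs (X (Suc n) - X n) < e) sequentially"
      using \<open>e > 0\<close> by (rule order_tendstoD(2))
    then obtain N where N: "\<And>n. n \<ge> N \<Longrightarrow> pabs (X (Suc n) - X n) < e"
      by (auto simp: eventually_sequentially)
    have "pabs (X (N + k) - X N) < e" for k
    proof (induction k)
      case (Suc k)
      then show ?case
        using pabs_diff_triangle[of "X (N + Suc k)" "X N" "X (N + k)"] N[of "N + k"] by simp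
    qed (use \<open>e > 0\<close> in simp)
    then have *: "pabs (X n - X N) < e" if "n \<ge> N" for n
      using that by (metis le_Suc_ex)
    have "dist (X m) (X n) < e" if "m \<ge> N" "n \<ge> N" for m n
      using pabs_diff_triangle[of "X m" "X n" "X N"] *[OF that(1)] *[OF that(2)]
      by (simp add: dist_pabs pabs_minus_commute[of "X N"])
    then show "\<exists>M. \<forall>m\<ge>M. \<forall>n\<ge>M. dist (X m) (X n) < e"
      by blast
  qed
  then show ?thesis
    by (rule Cauchy_convergent)
qed

lemma sums_padic:
  fixes f :: "nat \<Rightarrow> 'a"
  assumes "f \<longlonglongrightarrow> 0"
  shows "f sums suminf f"
proof -
  have "convergent (\<lambda>n. sum f {..<n})"
    by (rule convergent_of_differences) (use assms in simp)
  then obtain s where "f sums s"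
    by (auto simp: convergent_def sums_def)
  then show ?thesis
    using sums_unique by blast
qed

subsection \<open>The exponential\<close>

text \<open>The radius of convergence of the exponential, and the bound imposed on |1 - q|.\<close>

definition rho :: real where "rho = real p powr (- 1 / (real p - 1))"

lemma rho_pos: "rho > 0"
  and rho_power: "rho ^ (p - 1) = 1 / real p"
  and rho_gt: "1 / real p < rho"
  and rho_less_1: "rho < 1"
proof -
  show "rho > 0"
    using p_pos by (simp add: rho_def del: p_pos)
  then have "rho ^ (p - 1) = rho powr real (p - 1)"
    by (simp add: powr_realpow)
  also have "\<dots> = real p powr (-1)"
    using p_ge_3 by (simp add: rho_def powr_powr of_nat_diff field_simps)
  also have "\<dots> = 1 / real p"
    using p_ge_3 by (simp add: powr_minus divide_inverse)
  finally show "rho ^ (p - 1) = 1 / real p" .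
  show "rho < 1"
    using p_ge_3 powr_less_mono[of "- 1 / (real p - 1)" 0 "real p"]
    by (simp add: rho_def)
  have "real p powr (-1) < rho"
    unfolding rho_def using p_ge_3 by (intro powr_less_mono) (auto simp: field_simps)
  then show "1 / real p < rho"
    using p_ge_3 by (simp add: powr_minus divide_inverse)
qed

lemma pabs_fact_add_less:
  assumes "k < p"
  shows "pabs (fact (p * m + k) :: 'a) = pabs (fact (p * m) :: 'a)"
  using assms
proof (induction k)
  case (Suc k)
  have "\<not> p dvd Suc k"
    using Suc.prems by (auto dest: dvd_imp_le)
  then have "\<not> p dvd p * m + Suc k"
    by (metis dvd_add_right_iff dvd_triv_left)
  then have "pabs (of_nat (p * m + Suc k) :: 'a) = 1"
    by (rule pabs_of_nat_eq_1)
  then show ?case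
    using Suc by (simp add: pabs_mult)
qed simp

lemma pabs_fact_mult: "pabs (fact (p * m) :: 'a) = (1 / real p) ^ m * pabs (fact m :: 'a)"
proof (induction m)
  case (Suc m)
  have "p * Suc m = Suc (p * m + (p - 1))"
    using p_pos by simp
  then have "fact (p * Suc m) = (of_nat (p * Suc m) * fact (p * m + (p - 1)) :: 'a)"
    by (metis fact_Suc)
  then have "pabs (fact (p * Suc m) :: 'a) = pabs (of_nat p * of_nat (Suc m) :: 'a) * pabs (fact (p * m) :: 'a)"
    by (metis diff_less of_nat_mult p_pos pabs_fact_add_less pabs_mult zero_less_one)
  then show ?case
    unfolding Suc by (simp add: pabs_mult pabs_p)
qed simp

text \<open>Legendre's estimate: for n > 0 the exponent of p in n! is at most (n - 1)/(p - 1).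
  Passing from n to \<open>n div p\<close> extracts (1/p)^m = \<open>rho ^ ((p - 1) * m)\<close>.
  The exponent \<open>n - 1\<close> in place of n produces the extra factor \<open>rho\<close> in
  \<open>pabs_exp_term_le\<close>, which \<open>exp_approx\<close> needs in order to give |exp z -
  1| \<le> |z| on the whole disc.\<close>

lemma pabs_fact_ge: "pabs (fact n :: 'a) \<ge> rho ^ (n - 1)"
proof (induction n rule: less_induct)
  case (less n)
  define m where "m = n div p"
  have n: "n = p * m + n mod p"
    by (simp add: m_def)
  have fn: "pabs (fact n :: 'a) = (1 / real p) ^ m * pabs (fact m :: 'a)"
    using pabs_fact_add_less[of "n mod p" m] n pabs_fact_mult[of m] by simp
  show ?case
  proof (cases "m = 0")
    case True
    then show ?thesis
      using fn rho_pos rho_less_1 by (simp add: power_le_one)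
  next
    case False
    then have "m < n"
      using p_ge_3 unfolding m_def by (intro div_less_dividend) (auto intro: gr0I)
    have "(p - 1) * m + (m - 1) \<le> n - 1"
      using n p_ge_3 False by (cases p; cases m) auto
    then have "rho ^ (n - 1) \<le> rho ^ ((p - 1) * m + (m - 1))"
      using rho_pos rho_less_1 by (intro power_decreasing) auto
    also have "\<dots> = (1 / real p) ^ m * rho ^ (m - 1)"
      by (simp only: power_add power_mult rho_power)
    also have "\<dots> \<le> (1 / real p) ^ m * pabs (fact m :: 'a)"
      using less[OF \<open>m < n\<close>] by (intro mult_left_mono) auto
    finally show ?thesis
      by (simp add: fn)
  qed
qed

lemma pabs_exp_term_le:
  assumes "n > 0"
  shows "pabs ((x::'a) ^ n / fact n) \<le> rho * (pabs x / rho) ^ n"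
proof -
  have "pabs (x ^ n / fact n) \<le> pabs x ^ n / rho ^ (n - 1)"
    unfolding pabs_divide pabs_power using pabs_fact_ge[of n] rho_pos
    by (intro divide_left_mono mult_pos_pos zero_less_power less_le_trans[OF _ pabs_fact_ge[of n]]) auto
  also have "\<dots> = rho * (pabs x / rho) ^ n"
    using assms rho_pos by (cases n) (auto simp: power_divide)
  finally show ?thesis .
qed

lemma pabs_exp_term_le': "pabs ((x::'a) ^ n / fact n) \<le> (pabs x / rho) ^ n"
proof (cases "n = 0")
  case False
  then have "pabs (x ^ n / fact n) \<le> rho * (pabs x / rho) ^ n"
    by (intro pabs_exp_term_le) simp
  also have "\<dots> \<le> 1 * (pabs x / rho) ^ n"
    using rho_pos rho_less_1 by (intro mult_right_mono) auto
  finally show ?thesis by simp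
qed simp

lemma exp_tendsto:
  assumes "pabs (x::'a) < rho"
  shows "(\<lambda>n. \<Sum>k<n. x ^ k / fact k) \<longlonglongrightarrow> padic_exp x"
proof -
  have "(\<lambda>n. x ^ n / fact n) \<longlonglongrightarrow> 0"
  proof (rule tendsto_pabs_bound)
    show "pabs (x ^ n / fact n - 0) \<le> (pabs x / rho) ^ n" for n
      using pabs_exp_term_le' by simp
    show "(\<lambda>n. (pabs x / rho) ^ n) \<longlonglongrightarrow> 0"
      using assms rho_pos by (intro LIMSEQ_power_zero) simp
  qed
  then show ?thesis
    using sums_padic unfolding padic_exp_def sums_def by blast
qed

lemma exp_0 [simp]: "padic_exp (0::'a) = 1"
proof -
  have "(\<Sum>k<n. (0::'a) ^ k / fact k) = 1" if "n \<ge> 1" for n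
    using that by (subst sum.remove[of _ 0]) (auto intro!: sum.neutral)
  then have "(\<lambda>n. \<Sum>k<n. (0::'a) ^ k / fact k) \<longlonglongrightarrow> 1"
    by (intro tendsto_eventually eventually_sequentiallyI)
  then show ?thesis
    using exp_tendsto[of 0] rho_pos LIMSEQ_unique by auto
qed

text \<open>The product of the n-th partial sums differs from the n-th partial sum at
  \<open>x + y\<close> by the terms with i, j < n and i + j \<ge> n. Each of them is at most
  \<theta>^n in absolute value, and so is their sum, whatever their number.\<close>

lemma exp_add:
  assumes x: "pabs (x::'a) < rho" and y: "pabs y < rho"
  shows "padic_exp (x + y) = padic_exp x * padic_exp y"
proof -
  define f where "f z k = (z ^ k / fact k :: 'a)" for z k
  define S where "S z n = (\<Sum>k<n. f z k)" for z n
  define \<theta> where "\<theta> = max (pabs x) (pabs y) / rho"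
  have \<theta>: "0 \<le> \<theta>" "\<theta> < 1"
    using x y rho_pos by (auto simp: \<theta>_def le_max_iff_disj)
  have f_le: "pabs (f z k) \<le> \<theta> ^ k" if "z = x \<or> z = y" for z k
  proof -
    have "pabs (f z k) \<le> (pabs z / rho) ^ k"
      unfolding f_def by (rule pabs_exp_term_le')
    also have "\<dots> \<le> \<theta> ^ k"
      using rho_pos that unfolding \<theta>_def by (intro power_mono divide_right_mono) auto
    finally show ?thesis .
  qed
  have binom: "f (x + y) k = (\<Sum>i\<le>k. f x i * f y (k - i))" for k
    unfolding f_def binomial_ring sum_divide_distrib
    by (intro sum.cong) (auto simp: binomial_fact field_simps)
  have "(\<lambda>n. S x n * S y n - S (x + y) n) \<longlonglongrightarrow> 0"
  proof (rule tendsto_pabs_bound)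
    fix n :: nat
    let ?Q = "{..<n} \<times> {..<n}" and ?R = "{(i, j). i + j < n}"
    have "S x n * S y n = (\<Sum>(i, j)\<in>?Q. f x i * f y j)"
      by (simp add: S_def sum_product sum.cartesian_product)
    moreover have "S (x + y) n = (\<Sum>(i, j)\<in>?R. f x i * f y j)"
      by (simp add: S_def binom sum.triangle_reindex)
    moreover have "?R \<subseteq> ?Q"
      by auto
    ultimately have "S x n * S y n - S (x + y) n = (\<Sum>(i, j)\<in>?Q - ?R. f x i * f y j)"
      by (simp add: sum_diff)
    also have "pabs \<dots> \<le> \<theta> ^ n"
    proof (rule pabs_sum_le)
      fix z assume "z \<in> ?Q - ?R"
      then obtain i j where z: "z = (i, j)" "n \<le> i + j"
        by auto
      have "pabs (f x i * f y j) \<le> \<theta> ^ i * \<theta> ^ j"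
        unfolding pabs_mult using f_le \<theta> by (intro mult_mono) auto
      also have "\<dots> \<le> \<theta> ^ n"
        using \<theta> z by (simp flip: power_add add: power_decreasing)
      finally show "pabs (case z of (i, j) \<Rightarrow> f x i * f y j) \<le> \<theta> ^ n"
        by (simp add: z)
    qed (use \<theta> in simp)
    finally show "pabs (S x n * S y n - S (x + y) n - 0) \<le> \<theta> ^ n"
      by simp
  next
    show "(\<lambda>n. \<theta> ^ n) \<longlonglongrightarrow> 0"
      using \<theta> by (intro LIMSEQ_power_zero) simp
  qed
  moreover have "pabs (x + y) < rho"
    using pabs_add_le[of x y] x y by simp
  then have "(\<lambda>n. S x n * S y n - S (x + y) n) \<longlonglongrightarrow> padic_exp x * padic_exp y - padic_exp (x + y)"
    using x y unfolding S_def f_def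
    by (intro tendsto_padic_diff tendsto_padic_mult exp_tendsto)
  ultimately show ?thesis
    using LIMSEQ_unique by fastforce
qed

lemma exp_of_int_mult:
  assumes x: "pabs (x::'a) < rho"
  shows "padic_exp (of_int k * x) = padic_exp x powi k"
proof -
  have nat: "padic_exp (of_nat n * x) = padic_exp x ^ n" for n
  proof (induction n)
    case (Suc n)
    have "pabs (of_nat n * x) \<le> 1 * pabs x"
      unfolding pabs_mult by (intro mult_right_mono pabs_of_nat_le) simp
    then show ?case
      using Suc exp_add[OF x, of "of_nat n * x"] x by (simp add: distrib_right)
  qed simp
  show ?thesis
  proof (cases "k \<ge> 0")
    case True
    then show ?thesis
      using nat[of "nat k"] by (simp add: power_int_def)
  next
    case False
    let ?n = "nat (- k)"
    have "pabs (of_int k * x) \<le> 1 * pabs x"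
      unfolding pabs_mult using pabs_of_nat_le[of ?n] False pabs_minus[of "of_int k"]
      by (intro mult_right_mono) auto
    then have "padic_exp (of_int k * x + of_nat ?n * x) = padic_exp (of_int k * x) * padic_exp (of_nat ?n * x)"
      using x False pabs_minus[of "of_int k * x"] by (intro exp_add) auto
    then have "padic_exp (of_int k * x) * padic_exp x ^ ?n = 1"
      using False nat[of ?n] by simp
    then have "padic_exp (of_int k * x) = inverse (padic_exp x ^ ?n)"
      by (metis inverse_unique mult.commute)
    then show ?thesis
      using False by (simp add: power_int_def power_inverse)
  qed
qed

text \<open>Each term of degree at least 2 is bounded by |z|^2/\<open>rho\<close>. For z = p^N y
  this error is quadratic in p^(-N), so it still tends to 0 after division by p^N, as
  \<open>plog_exp\<close> requires.\<close>

lemma exp_approx: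
  assumes "pabs (z::'a) < rho"
  shows "pabs (padic_exp z - 1 - z) \<le> pabs z ^ 2 / rho"
proof -
  have "pabs (padic_exp z - (1 + z)) \<le> pabs z ^ 2 / rho"
  proof (rule pabs_tendsto_le[OF exp_tendsto[OF assms]])
    fix n :: nat assume "n \<ge> 2"
    then have "{..<n} = {0, 1} \<union> {2..<n}"
      by auto
    then have "(\<Sum>k<n. z ^ k / fact k) = (\<Sum>k\<in>{0, 1} \<union> {2..<n}. z ^ k / fact k)"
      by simp
    also have "\<dots> = 1 + z + (\<Sum>k\<in>{2..<n}. z ^ k / fact k)"
      by (subst sum.union_disjoint) auto
    finally have "(\<Sum>k<n. z ^ k / fact k) - (1 + z) = (\<Sum>k\<in>{2..<n}. z ^ k / fact k)"
      by simp
    also have "pabs \<dots> \<le> pabs z ^ 2 / rho"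
    proof (rule pabs_sum_le)
      fix k assume "k \<in> {2..<n}"
      then have "pabs (z ^ k / fact k) \<le> rho * (pabs z / rho) ^ k"
        by (intro pabs_exp_term_le) auto
      also have "\<dots> \<le> rho * (pabs z / rho) ^ 2"
        using \<open>k \<in> {2..<n}\<close> assms rho_pos by (intro mult_left_mono power_decreasing) auto
      also have "\<dots> = pabs z ^ 2 / rho"
        using rho_pos by (simp add: power2_eq_square)
      finally show "pabs (z ^ k / fact k) \<le> pabs z ^ 2 / rho" .
    qed (use rho_pos in simp)
    finally show "pabs ((\<Sum>k<n. z ^ k / fact k) - (1 + z)) \<le> pabs z ^ 2 / rho" .
  qed
  then show ?thesis
    by (simp add: diff_diff_eq)
qed

lemma pabs_exp_minus_1_le:
  assumes "pabs (z::'a) < rho"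
  shows "pabs (padic_exp z - 1) \<le> pabs z"
proof -
  have "pabs z ^ 2 / rho \<le> pabs z"
    using assms rho_pos by (simp add: power2_eq_square pos_divide_le_eq mult_left_mono)
  then show ?thesis
    using exp_approx[OF assms] pabs_add_le[of "padic_exp z - 1 - z" z] by simp
qed

subsection \<open>The logarithm\<close>

lemma log1p_tendsto:
  assumes "pabs (x::'a) < 1"
  shows "(\<lambda>n. \<Sum>k<n. (- 1) ^ k * x ^ Suc k / of_nat (Suc k)) \<longlonglongrightarrow> padic_log1p x"
proof -
  have "(\<lambda>k. (- 1) ^ k * x ^ Suc k / of_nat (Suc k)) \<longlonglongrightarrow> 0"
  proof (rule tendsto_pabs_bound)
    fix k
    have "pabs (x ^ Suc k) / pabs (of_nat (Suc k) :: 'a) \<le> pabs (x ^ Suc k) / (1 / real (Suc k))"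
      using pabs_of_nat_ge[of "Suc k"]
      by (intro divide_left_mono mult_pos_pos less_le_trans[OF _ pabs_of_nat_ge]) auto
    then show "pabs ((- 1) ^ k * x ^ Suc k / of_nat (Suc k) - 0) \<le> real (Suc k) * pabs x ^ Suc k"
      by (simp add: pabs_mult pabs_divide pabs_power mult.commute del: of_nat_Suc power_Suc)
  next
    show "(\<lambda>k. real (Suc k) * pabs x ^ Suc k) \<longlonglongrightarrow> 0"
      using assms by (intro LIMSEQ_Suc powser_times_n_limit_0) simp
  qed
  then show ?thesis
    using sums_padic unfolding padic_log1p_def sums_def by blast
qed

lemma pabs_p_power: "pabs (of_nat (p ^ N) :: 'a) = 1 / real p ^ N"
  by (simp add: pabs_power pabs_p power_one_over)

text \<open>The coefficients of \<open>((1 + x) ^ (p ^ N) - 1) / p ^ N\<close> approximate those of the logarithm.\<close>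

lemma pabs_binomial_minus_sign_le:
  "pabs (of_nat (p ^ N - 1 choose k) - (- 1) ^ k :: 'a) \<le> real k / real p ^ N"
proof (induction k)
  case (Suc k)
  have pN: "Suc (p ^ N - 1) = p ^ N"
    by simp
  \<comment> \<open>With P = p^N, the absorption identity (k+1) C(P, k+1) = P C(P-1, k) makes C(P,
    k+1) small; Pascal's rule below then passes from k to k+1 with the sign reversed.\<close>
  have "Suc k * (p ^ N choose Suc k) = p ^ N * (p ^ N - 1 choose k)"
    using Suc_times_binomial[of k "p ^ N - 1"] unfolding pN .
  then have "pabs (of_nat (Suc k) * of_nat (p ^ N choose Suc k) :: 'a) \<le> 1 / real p ^ N * 1"
    using mult_left_mono[OF pabs_of_nat_le[of "p ^ N - 1 choose k"], of "1 / real p ^ N"]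
    by (simp only: flip: of_nat_mult) (simp add: pabs_mult pabs_p_power[simplified])
  then have "pabs (of_nat (p ^ N choose Suc k) :: 'a) * pabs (of_nat (Suc k) :: 'a) \<le> 1 / real p ^ N"
    by (simp only: pabs_mult mult.commute mult_1_right)
  moreover have "pabs (of_nat (p ^ N choose Suc k) :: 'a) * (1 / real (Suc k))
      \<le> pabs (of_nat (p ^ N choose Suc k) :: 'a) * pabs (of_nat (Suc k) :: 'a)"
    by (intro mult_left_mono pabs_of_nat_ge) auto
  ultimately have "pabs (of_nat (p ^ N choose Suc k) :: 'a) * (1 / real (Suc k)) \<le> 1 / real p ^ N"
    by linarith
  then have 1: "pabs (of_nat (p ^ N choose Suc k) :: 'a) \<le> real (Suc k) / real p ^ N"
    by (simp add: field_simps)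
  have "real k / real p ^ N \<le> real (Suc k) / real p ^ N"
    by (intro divide_right_mono) auto
  with Suc.IH have 2: "pabs (of_nat (p ^ N - 1 choose k) - (- 1) ^ k :: 'a) \<le> real (Suc k) / real p ^ N"
    by linarith
  have "p ^ N choose Suc k = (p ^ N - 1 choose k) + (p ^ N - 1 choose Suc k)"
    using binomial_Suc_Suc[of "p ^ N - 1" k] unfolding pN .
  then have eq: "of_nat (p ^ N - 1 choose Suc k) - (- 1) ^ Suc k
      = (of_nat (p ^ N choose Suc k) - (of_nat (p ^ N - 1 choose k) - (- 1) ^ k) :: 'a)"
    by simp
  show ?case
    unfolding eq using 1 2 by (rule pabs_diff_leI)
qed simp

text \<open>Both the binomial expansion and the partial sum \<open>S\<close> are taken with p^N
  terms, so only their coefficients have to be compared. The result replaces the series by algebraic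
  expressions in 1 + x.\<close>

lemma log1p_limit:
  assumes x: "pabs (x::'a) < 1"
  shows "(\<lambda>N. ((1 + x) ^ (p ^ N) - 1) / of_nat (p ^ N)) \<longlonglongrightarrow> padic_log1p x"
proof -
  \<comment> \<open>Splitting |x|^(k+1) as s times s^k times s^(k+1) turns k (k+1) |x|^(k+1) into s
    times a product of two null sequences n s^n, whence the bound \<open>B\<close>. The factor k
    comes from the coefficient error, the factor k+1 from the denominator.\<close>
  define s where "s = sqrt (pabs x)"
  define S where "S n = (\<Sum>k<n. (- 1) ^ k * x ^ Suc k / of_nat (Suc k))" for n
  have s: "0 \<le> s" "s < 1" "s * s = pabs x"
    using x by (auto simp: s_def)
  have lim: "(\<lambda>k. real k * s ^ k) \<longlonglongrightarrow> 0"
    using s by (intro powser_times_n_limit_0) simp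
  have "(\<lambda>k. s * (real k * s ^ k) * (real (Suc k) * s ^ Suc k)) \<longlonglongrightarrow> s * 0 * 0"
    using LIMSEQ_Suc[OF lim] lim by (intro tendsto_mult tendsto_const)
  also have "(\<lambda>k. s * (real k * s ^ k) * (real (Suc k) * s ^ Suc k)) = (\<lambda>k. real k * real (Suc k) * pabs x ^ Suc k)"
    by (simp flip: s(3) add: power_mult_distrib mult_ac)
  finally have "Bseq (\<lambda>k. real k * real (Suc k) * pabs x ^ Suc k)"
    by (intro convergent_imp_Bseq convergentI)
  then obtain B where B: "B > 0" "\<And>k. real k * real (Suc k) * pabs x ^ Suc k \<le> B"
    by (auto elim!: BseqE simp: abs_mult)
  have "(\<lambda>N. ((1 + x) ^ (p ^ N) - 1) / of_nat (p ^ N) - S (p ^ N)) \<longlonglongrightarrow> 0"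
  proof (rule tendsto_pabs_bound)
    fix N
    define P where "P = p ^ N"
    have P: "P > 0" "Suc (P - 1) = P"
      by (auto simp: P_def)
    have coeff: "of_nat (P choose Suc k) * x ^ Suc k / of_nat P = of_nat (P - 1 choose k) * x ^ Suc k / of_nat (Suc k)" for k
    proof -
      have "Suc k * (P choose Suc k) = P * (P - 1 choose k)"
        using Suc_times_binomial[of k "P - 1"] unfolding P(2) .
      then have "of_nat (Suc k) * of_nat (P choose Suc k) = (of_nat P * of_nat (P - 1 choose k) :: 'a)"
        by (metis of_nat_mult)
      then have "(of_nat (P choose Suc k) :: 'a) / of_nat P = of_nat (P - 1 choose k) / of_nat (Suc k)"
        using P(1) by (simp add: field_simps del: of_nat_Suc)
      then show ?thesis
        by (metis times_divide_eq_left)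
    qed
    have "(1 + x) ^ P = (\<Sum>k\<le>P. of_nat (P choose k) * x ^ k)"
      using binomial_ring[of x 1 P] by (simp add: add.commute)
    also have "\<dots> = 1 + (\<Sum>k<P. of_nat (P choose Suc k) * x ^ Suc k)"
      by (simp add: sum.atMost_shift)
    finally have "((1 + x) ^ P - 1) / of_nat P = (\<Sum>k<P. of_nat (P - 1 choose k) * x ^ Suc k / of_nat (Suc k))"
      by (simp only: add_diff_cancel_left' sum_divide_distrib coeff)
    then have "((1 + x) ^ P - 1) / of_nat P - S P
        = (\<Sum>k<P. (of_nat (P - 1 choose k) - (- 1) ^ k) * x ^ Suc k / of_nat (Suc k))"
      by (simp only: S_def left_diff_distrib diff_divide_distrib sum_subtractf)
    also have "pabs \<dots> \<le> B * (1 / real p) ^ N"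
    proof (rule pabs_sum_le)
      fix k
      have "pabs ((of_nat (P - 1 choose k) - (- 1) ^ k :: 'a)) * pabs x ^ Suc k / pabs (of_nat (Suc k) :: 'a)
          \<le> (real k / real p ^ N) * pabs x ^ Suc k / (1 / real (Suc k))"
        unfolding P_def using pabs_of_nat_ge[of "Suc k"]
        by (intro frac_le mult_right_mono mult_nonneg_nonneg pabs_binomial_minus_sign_le) auto
      also have "\<dots> = (real k * real (Suc k) * pabs x ^ Suc k) * (1 / real p) ^ N"
        by (simp add: power_one_over)
      also have "\<dots> \<le> B * (1 / real p) ^ N"
        using B(2) by (intro mult_right_mono) auto
      finally show "pabs ((of_nat (P - 1 choose k) - (- 1) ^ k) * x ^ Suc k / of_nat (Suc k)) \<le> B * (1 / real p) ^ N"
        by (simp only: pabs_mult pabs_divide pabs_power)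
    qed (use B in simp)
    finally show "pabs (((1 + x) ^ (p ^ N) - 1) / of_nat (p ^ N) - S (p ^ N) - 0) \<le> B * (1 / real p) ^ N"
      by (simp add: P_def)
  next
    show "(\<lambda>N. B * (1 / real p) ^ N) \<longlonglongrightarrow> 0"
      using p_ge_3 by (intro tendsto_mult_right_zero LIMSEQ_power_zero) simp
  qed
  moreover have "(\<lambda>N. S (p ^ N)) \<longlonglongrightarrow> padic_log1p x"
  proof -
    have "strict_mono (\<lambda>N. p ^ N)"
      using p_ge_3 by (simp add: strict_mono_def)
    then show ?thesis
      using LIMSEQ_subseq_LIMSEQ[OF log1p_tendsto[OF x]] by (simp add: S_def o_def)
  qed
  ultimately show ?thesis
    using tendsto_padic_add by fastforce
qed

section \<open>The logarithm as an isometric homomorphism\<close>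

definition plog :: "'a \<Rightarrow> 'a" where "plog u = padic_log1p (u - 1)"

lemma plog_tendsto:
  assumes "pabs (u - 1) < 1"
  shows "(\<lambda>N. (u ^ (p ^ N) - 1) / of_nat (p ^ N)) \<longlonglongrightarrow> plog u"
  using log1p_limit[OF assms] by (simp add: plog_def)

lemma p_power_tendsto_0: "(\<lambda>N. of_nat (p ^ N) :: 'a) \<longlonglongrightarrow> 0"
proof (rule tendsto_pabs_bound)
  show "pabs (of_nat (p ^ N) - 0 :: 'a) \<le> (1 / real p) ^ N" for N
    using pabs_p_power[of N] by (simp add: power_one_over)
  show "(\<lambda>N. (1 / real p) ^ N) \<longlonglongrightarrow> 0"
    using p_ge_3 by (intro LIMSEQ_power_zero) simp
qed

lemma pabs_mult_minus_1_less:
  assumes "pabs ((u::'a) - 1) < c" "pabs (v - 1) < c" "c \<le> 1"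
  shows "pabs (u * v - 1) < c"
proof -
  have "pabs (u * (v - 1)) < c"
    using assms pabs_eq_1[of u] by (simp add: pabs_mult)
  then have "pabs (u * (v - 1) + (u - 1)) < c"
    using assms(1) by (rule pabs_add_lessI)
  then show ?thesis
    by (simp add: algebra_simps)
qed

lemma pabs_power_minus_1_less:
  assumes "pabs ((u::'a) - 1) < c" "c \<le> 1"
  shows "pabs (u ^ k - 1) < c"
proof (induction k)
  case 0
  show ?case using le_less_trans[OF pabs_nonneg assms(1)] by simp
next
  case (Suc k)
  then show ?case
    using pabs_mult_minus_1_less[OF assms(1) Suc assms(2)] by simp
qed

lemma pabs_power_minus_1_le:
  assumes "pabs ((u::'a) - 1) < 1"
  shows "pabs (u ^ k - 1) \<le> pabs (u - 1)"
proof (induction k)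
  case (Suc k)
  have "pabs (u * (u ^ k - 1) + (u - 1)) \<le> pabs (u - 1)"
    using Suc pabs_eq_1[OF assms] by (intro pabs_add_leI) (simp_all add: pabs_mult)
  then show ?case
    by (simp add: algebra_simps)
qed simp

text \<open>With P = p^N and A(u) = (u^P - 1)/P, expanding (uv)^P - 1 gives A(uv) = P A(u) A(v) +
  A(u) + A(v), and P tends to 0.\<close>

lemma plog_mult:
  assumes u: "pabs (u - 1) < 1" and v: "pabs (v - 1) < 1"
  shows "plog (u * v) = plog u + plog v"
proof -
  define A where "A w N = (w ^ (p ^ N) - 1) / of_nat (p ^ N)" for w :: 'a and N
  have lim: "A w \<longlonglongrightarrow> plog w" if "pabs (w - 1) < 1" for w
    using plog_tendsto[OF that] unfolding A_def .
  have A: "A (u * v) N = of_nat (p ^ N) * (A u N * A v N) + (A u N + A v N)" for N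
    by (simp add: A_def field_simps power_mult_distrib)
  have "(\<lambda>N. of_nat (p ^ N) * (A u N * A v N) + (A u N + A v N)) \<longlonglongrightarrow> 0 * (plog u * plog v) + (plog u + plog v)"
    by (intro tendsto_padic_add tendsto_padic_mult p_power_tendsto_0 lim u v)
  moreover have "A (u * v) \<longlonglongrightarrow> plog (u * v)"
    using u v by (intro lim pabs_mult_minus_1_less) auto
  ultimately show ?thesis
    using LIMSEQ_unique unfolding A[abs_def] by fastforce
qed

lemma plog_1: "plog 1 = 0"
  using plog_mult[of 1 1] by simp

lemma plog_power:
  assumes "pabs (u - 1) < 1"
  shows "plog (u ^ k) = of_nat k * plog u"
proof (induction k)
  case (Suc k)
  then show ?case
    using plog_mult[OF assms pabs_power_minus_1_less[OF assms]] by (simp add: distrib_right)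
qed (simp add: plog_1)

text \<open>In (1 + x)^p - 1 with x nonzero the term p x strictly dominates: the middle binomial
  coefficients are divisible by p and come with at least x^2, and |x|^p < |x|
  \<open>rho ^ (p - 1)\<close> = |x|/p. The last bound is where the radius \<open>rho\<close>
  enters.\<close>

lemma pabs_pth_power_minus_1:
  assumes u: "pabs ((u::'a) - 1) < rho"
  shows "pabs (u ^ p - 1) = pabs (u - 1) / real p"
proof (cases "u = 1")
  case False
  define x where "x = u - 1"
  have x: "pabs x > 0" "pabs x < rho"
    using False u by (auto simp: x_def less_le)
  have "u ^ p = (\<Sum>k\<le>p. of_nat (p choose k) * x ^ k)"
    using binomial_ring[of x 1 p] by (simp add: x_def)
  also have "{..p} = {0, 1, p} \<union> {2..<p}"
    using p_ge_3 by auto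
  also have "(\<Sum>k\<in>\<dots>. of_nat (p choose k) * x ^ k)
      = 1 + of_nat p * x + (x ^ p + (\<Sum>k\<in>{2..<p}. of_nat (p choose k) * x ^ k))"
    using p_ge_3 by (subst sum.union_disjoint) (auto simp: add.assoc)
  finally have *: "u ^ p - 1 = of_nat p * x + (x ^ p + (\<Sum>k\<in>{2..<p}. of_nat (p choose k) * x ^ k))"
    by simp
  have "pabs x ^ p = pabs x * pabs x ^ (p - 1)"
    by (simp flip: power_Suc)
  also have "\<dots> < pabs x * rho ^ (p - 1)"
    using x p_ge_3 by (intro mult_strict_left_mono power_strict_mono) auto
  finally have 1: "pabs (x ^ p) < pabs x / real p"
    unfolding rho_power by (simp add: pabs_power)
  have "pabs (\<Sum>k\<in>{2..<p}. of_nat (p choose k) * x ^ k) \<le> pabs x ^ 2 / real p"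
  proof (rule pabs_sum_le)
    fix k assume k: "k \<in> {2..<p}"
    then have "pabs (of_nat (p choose k) :: 'a) \<le> 1 / real p"
      using prime_p by (intro pabs_of_nat_dvd_le dvd_choose_prime) auto
    moreover have "pabs x ^ k \<le> pabs x ^ 2"
      using k x rho_less_1 by (intro power_decreasing) auto
    ultimately have "pabs (of_nat (p choose k) :: 'a) * pabs x ^ k \<le> 1 / real p * pabs x ^ 2"
      by (intro mult_mono) auto
    then show "pabs (of_nat (p choose k) * x ^ k) \<le> pabs x ^ 2 / real p"
      by (simp add: pabs_mult pabs_power)
  qed simp
  also have "\<dots> < pabs x / real p"
    using x rho_less_1 p_ge_3 by (intro divide_strict_right_mono) (auto simp: power2_eq_square)
  finally have "pabs (x ^ p + (\<Sum>k\<in>{2..<p}. of_nat (p choose k) * x ^ k)) < pabs x / real p"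
    using 1 le_less_trans[OF pabs_add_le] by (metis max_less_iff_conj)
  then show ?thesis
    unfolding * by (subst pabs_add_eq_left) (simp_all add: pabs_mult pabs_p x_def)
qed simp

text \<open>Iterating the p-th power shows that every approximant (u^(p^N) - 1)/p^N has absolute
  value exactly |u - 1|.\<close>

lemma pabs_plog:
  assumes u: "pabs (u - 1) < rho"
  shows "pabs (plog u) = pabs (u - 1)"
proof -
  have *: "pabs (u ^ (p ^ N) - 1) = pabs (u - 1) / real p ^ N" for N
  proof (induction N)
    case (Suc N)
    have "pabs (u ^ (p ^ N) - 1) < rho"
      using u rho_less_1 by (intro pabs_power_minus_1_less) auto
    then have "pabs ((u ^ (p ^ N)) ^ p - 1) = pabs (u ^ (p ^ N) - 1) / real p"
      by (rule pabs_pth_power_minus_1)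
    then show ?case
      using Suc by (simp add: mult.commute flip: power_mult)
  qed simp
  have "(\<lambda>N. pabs ((u ^ (p ^ N) - 1) / of_nat (p ^ N))) \<longlonglongrightarrow> pabs (plog u)"
    using u rho_less_1 by (intro tendsto_pabs plog_tendsto) simp
  then have "(\<lambda>N. pabs (u - 1)) \<longlonglongrightarrow> pabs (plog u)"
    using p_ge_3 by (simp add: pabs_divide pabs_p_power[simplified] *)
  then show ?thesis
    by (simp add: LIMSEQ_const_iff)
qed

text \<open>Since exp(y)^(p^N) = exp(p^N y), the approximants of the logarithm are difference
  quotients of the exponential at 0, and \<open>exp_approx\<close> identifies their limit.\<close>

lemma plog_exp:
  assumes y: "pabs (y::'a) < rho"
  shows "plog (padic_exp y) = y"
proof -
  have "pabs (padic_exp y - 1) < 1"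
    using pabs_exp_minus_1_le[OF y] y rho_less_1 by simp
  then have "(\<lambda>N. (padic_exp y ^ (p ^ N) - 1) / of_nat (p ^ N)) \<longlonglongrightarrow> plog (padic_exp y)"
    by (rule plog_tendsto)
  moreover have "(\<lambda>N. (padic_exp y ^ (p ^ N) - 1) / of_nat (p ^ N)) \<longlonglongrightarrow> y"
  proof (rule tendsto_pabs_bound)
    fix N
    define z where "z = of_nat (p ^ N) * y"
    have "pabs z = pabs y / real p ^ N"
      unfolding z_def pabs_mult pabs_p_power by simp
    moreover have "pabs y / real p ^ N \<le> pabs y / 1"
      using p_ge_3 by (intro divide_left_mono one_le_power) auto
    ultimately have z: "pabs z < rho" "pabs z = pabs y / real p ^ N"
      using y by auto
    have "padic_exp y ^ (p ^ N) = padic_exp z"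
      using exp_of_int_mult[OF y, of "int (p ^ N)"] by (simp add: z_def power_int_def nat_power_eq)
    then have "(padic_exp y ^ (p ^ N) - 1) / of_nat (p ^ N) - y = (padic_exp z - 1 - z) / of_nat (p ^ N)"
      by (simp add: z_def field_simps)
    also have "pabs \<dots> \<le> (pabs z ^ 2 / rho) * real p ^ N"
      using mult_right_mono[OF exp_approx[OF z(1)], of "real p ^ N"] unfolding pabs_divide pabs_p_power by simp
    also have "\<dots> = pabs y ^ 2 / rho * (1 / real p) ^ N"
      using p_ge_3 by (simp add: z(2) power2_eq_square power_one_over)
    finally show "pabs ((padic_exp y ^ (p ^ N) - 1) / of_nat (p ^ N) - y) \<le> pabs y ^ 2 / rho * (1 / real p) ^ N" .
  next
    show "(\<lambda>N. pabs y ^ 2 / rho * (1 / real p) ^ N) \<longlonglongrightarrow> 0"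
      using p_ge_3 by (intro tendsto_mult_right_zero LIMSEQ_power_zero) simp
  qed
  ultimately show ?thesis
    by (rule LIMSEQ_unique)
qed

text \<open>The logarithm is an isometric homomorphism, so it is injective, and its right inverse
  is a left inverse.\<close>

lemma exp_plog:
  assumes u: "pabs (u - 1) < rho"
  shows "padic_exp (plog u) = u"
proof -
  define v where "v = padic_exp (plog u)"
  have lu: "pabs (plog u) < rho"
    using u pabs_plog by simp
  then have v: "pabs (v - 1) < rho"
    using pabs_exp_minus_1_le unfolding v_def by (metis le_less_trans)
  have lv: "plog v = plog u"
    unfolding v_def by (rule plog_exp[OF lu])
  have u1: "pabs u = 1"
    using u rho_less_1 by (intro pabs_eq_1) simp
  have "u \<noteq> 0"
    using u1 by auto
  define w where "w = v / u"
  have "w - 1 = ((v - 1) - (u - 1)) / u"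
    using \<open>u \<noteq> 0\<close> by (simp add: w_def field_simps)
  then have w: "pabs (w - 1) < rho"
    using pabs_diff_le[of "v - 1" "u - 1"] u v u1 by (simp add: pabs_divide)
  have "plog v = plog w + plog u"
    using plog_mult[of w u] w u rho_less_1 \<open>u \<noteq> 0\<close> by (simp add: w_def)
  then have "plog w = 0"
    using lv by simp
  then have "w = 1"
    using pabs_plog[OF w] by simp
  then show ?thesis
    using \<open>u \<noteq> 0\<close> by (simp add: w_def v_def)
qed

text \<open>The choice \<open>m = 1\<close>, \<open>k = 0\<close> is admissible because u already
  lies in the disc. For any other choice |u| = |v| = 1 forces \<open>k = 0\<close>, hence
  \<open>v = u ^ m\<close>, and \<open>plog_power\<close> cancels the denominator
  \<open>m\<close>.\<close>

lemma iwasawa_log_eq_plog: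
  assumes u: "pabs (u - 1) < 1"
  shows "iwasawa_log p u = plog u"
  unfolding iwasawa_log_def
proof (rule the_equality)
  show "\<exists>m>0. \<exists>(k::int) v. u ^ m = of_nat p powi k * v \<and> pabs (v - 1) < 1 \<and> plog u = padic_log1p (v - 1) / of_nat m"
    using u by (intro exI[of _ "1::nat"] conjI exI[of _ "0::int"] exI[of _ u]) (simp_all add: plog_def)
next
  fix y
  assume "\<exists>m>0. \<exists>(k::int) v. u ^ m = of_nat p powi k * v \<and> pabs (v - 1) < 1 \<and> y = padic_log1p (v - 1) / of_nat m"
  then obtain m and k :: int and v where *: "m > 0" "u ^ m = of_nat p powi k * v" "pabs (v - 1) < 1"
    "y = plog v / of_nat m"
    by (auto simp: plog_def)
  have "(1 / real p) powi k = 1"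
    using arg_cong[OF *(2), of pabs] pabs_eq_1[OF u] pabs_eq_1[OF *(3)]
    by (simp add: pabs_mult pabs_power pabs_power_int pabs_p)
  then have "real p powi k = 1"
    by (simp add: power_int_divide_distrib)
  then have "k = 0"
    using one_less_power_int[of "real p" k] one_less_power_int[of "real p" "- k"] p_ge_3
    by (cases k "0 :: int" rule: linorder_cases) (auto simp: power_int_minus)
  then have "v = u ^ m"
    using *(2) by simp
  then show "y = plog u"
    using *(1,4) plog_power[OF u] by simp
qed

lemma exp_of_int_mult_iwasawa_log:
  assumes "pabs ((u::'a) - 1) < rho"
  shows "padic_exp (of_int k * iwasawa_log p u) = u powi k"
  using assms rho_less_1 exp_of_int_mult[of "plog u" k]
  by (simp add: iwasawa_log_eq_plog exp_plog pabs_plog)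

subsection \<open>The Teichmueller character\<close>

text \<open>The cofactor of \<open>x - y\<close> in \<open>x ^ p - y ^ p\<close> is p y^(p-1) plus a
  combination of the differences x^i - y^i, and both parts are at most 1/p. This contraction drives
  the construction of Teichmueller representatives.\<close>

lemma pabs_pth_power_diff_le:
  assumes "pabs (x::'a) \<le> 1" and "pabs y \<le> 1" and xy: "pabs (x - y) \<le> 1 / real p"
  shows "pabs (x ^ p - y ^ p) \<le> pabs (x - y) / real p"
proof -
  have yi: "pabs (y ^ i) \<le> 1" and xi: "pabs (x ^ i) \<le> 1" for i
    using assms by (simp_all add: pabs_power power_le_one)
  have pw: "pabs (x ^ i - y ^ i) \<le> 1 / real p" for i
  proof (induction i)
    case (Suc i)
    have "x ^ Suc i - y ^ Suc i = x * (x ^ i - y ^ i) + (x - y) * y ^ i"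
      by (simp add: algebra_simps)
    moreover have "pabs (x * (x ^ i - y ^ i)) \<le> 1 * (1 / real p)" "pabs ((x - y) * y ^ i) \<le> (1 / real p) * 1"
      unfolding pabs_mult using Suc assms yi by (intro mult_mono; simp)+
    ultimately show ?case
      using pabs_add_le[of "x * (x ^ i - y ^ i)" "(x - y) * y ^ i"] by simp
  qed simp
  have "x ^ p - y ^ p = (x - y) * (\<Sum>i<p. y ^ (p - Suc i) * x ^ i)"
    by (rule power_diff_sumr2)
  also have "(\<Sum>i<p. y ^ (p - Suc i) * x ^ i)
      = (\<Sum>i<p. y ^ (p - Suc i) * (x ^ i - y ^ i)) + (\<Sum>i<p. y ^ (p - Suc i) * y ^ i)"
    by (simp add: right_diff_distrib sum_subtractf)
  also have "(\<Sum>i<p. y ^ (p - Suc i) * y ^ i) = (\<Sum>i<p. y ^ (p - 1))"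
    by (intro sum.cong) (auto simp flip: power_add)
  finally have *: "x ^ p - y ^ p = (x - y) * ((\<Sum>i<p. y ^ (p - Suc i) * (x ^ i - y ^ i)) + of_nat p * y ^ (p - 1))"
    by simp
  have "pabs (\<Sum>i<p. y ^ (p - Suc i) * (x ^ i - y ^ i)) \<le> 1 / real p"
  proof (rule pabs_sum_le)
    show "pabs (y ^ (p - Suc i) * (x ^ i - y ^ i)) \<le> 1 / real p" for i
      using mult_mono[OF yi[of "p - Suc i"] pw[of i]] by (simp add: pabs_mult)
  qed simp
  moreover have "pabs (of_nat p * y ^ (p - 1)) \<le> 1 / real p"
    using mult_left_mono[OF yi[of "p - 1"], of "1 / real p"] by (simp add: pabs_mult pabs_p)
  ultimately have "pabs ((\<Sum>i<p. y ^ (p - Suc i) * (x ^ i - y ^ i)) + of_nat p * y ^ (p - 1)) \<le> 1 / real p"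
    using order_trans[OF pabs_add_le] by (metis max.boundedI)
  then show ?thesis
    unfolding * pabs_mult using mult_left_mono[OF _ pabs_nonneg[of "x - y"]] by fastforce
qed

text \<open>The sum 1 + w + ... + w^(p-2) is within |w - 1| < 1 of the unit p - 1, hence nonzero,
  while its product with w - 1 is 0.\<close>

lemma root_of_unity_eq_1:
  assumes "(w::'a) ^ (p - 1) = 1" and "pabs (w - 1) < 1"
  shows "w = 1"
proof (rule ccontr)
  assume "w \<noteq> 1"
  have "pabs (\<Sum>i<p - 1. w ^ i - 1) \<le> pabs (w - 1)"
  proof (rule pabs_sum_le)
    show "pabs (w ^ i - 1) \<le> pabs (w - 1)" for i
      using assms(2) by (rule pabs_power_minus_1_le)
  qed simp
  moreover have "\<not> p dvd p - 1"
    using p_ge_3 by (auto dest: dvd_imp_le)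
  then have "pabs (of_nat (p - 1) :: 'a) = 1"
    by (rule pabs_of_nat_eq_1)
  ultimately have "pabs (of_nat (p - 1) + (\<Sum>i<p - 1. w ^ i - 1)) = 1"
    using assms(2) by (subst pabs_add_eq_left) auto
  moreover have "of_nat (p - 1) + (\<Sum>i<p - 1. w ^ i - 1) = (\<Sum>i<p - 1. w ^ i)"
    by (simp add: sum_subtractf)
  moreover have "(w - 1) * (\<Sum>i<p - 1. w ^ i) = 0"
    using power_diff_1_eq[of w "p - 1"] assms(1) by simp
  ultimately show False
    using \<open>w \<noteq> 1\<close> by simp
qed

lemma teichmueller_unique:
  assumes "\<not> p dvd a" and "(z::'a) ^ (p - 1) = 1" "pabs (z - of_nat a) < 1"
    and "z' ^ (p - 1) = 1" "pabs (z' - of_nat a) < 1"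
  shows "z = z'"
proof -
  have "z' \<noteq> 0"
    using assms(4) p_ge_3 by (auto simp: power_0_left split: if_splits)
  have "pabs z' ^ (p - 1) = 1"
    using assms(4) by (simp flip: pabs_power)
  then have "pabs z' = 1"
    using p_ge_3 power_eq_1_iff[of "pabs z'" "p - 1"] by simp
  moreover have "pabs (z - z') < 1"
    using pabs_diff_triangle[of z z' "of_nat a"] assms(3,5) by (simp add: pabs_minus_commute)
  moreover have "z / z' - 1 = (z - z') / z'"
    using \<open>z' \<noteq> 0\<close> by (simp add: field_simps)
  ultimately have "pabs (z / z' - 1) < 1"
    by (simp add: pabs_divide)
  moreover have "(z / z') ^ (p - 1) = 1"
    by (simp only: power_divide assms(2,4) div_by_1)
  ultimately have "z / z' = 1"
    using root_of_unity_eq_1 by blast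
  then show ?thesis
    using \<open>z' \<noteq> 0\<close> by simp
qed

text \<open>z is the limit of a^(p^N): Fermat's little theorem bounds the first step by 1/p, and
  each later step gains another factor 1/p. The limit satisfies z^p = z and is nonzero, being close
  to the unit a. The distance 1/p, sharper than the bound 1 in the definition, later places
  [a]_q/\<omega>(a) in the disc of radius \<open>rho\<close> around 1.\<close>

lemma teichmueller_exists:
  assumes "\<not> p dvd a"
  obtains z :: 'a where "z ^ (p - 1) = 1" and "pabs (z - of_nat a) \<le> 1 / real p"
proof -
  define X where "X N = (of_nat a :: 'a) ^ (p ^ N)" for N
  have X_Suc: "X (Suc N) = X N ^ p" for N
    by (simp add: X_def mult.commute flip: power_mult)
  have X_le: "pabs (X N) \<le> 1" for N
    by (simp add: X_def pabs_power power_le_one pabs_of_nat_le)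
  have "[a ^ (p - 1) * a = 1 * a] (mod p)"
    using fermat_theorem[OF prime_p assms] by (rule cong_scalar_right)
  then have "[a ^ p = a] (mod p)"
    using power_minus_mult[OF p_pos, of a] by simp
  then have "int p dvd int (a ^ p) - int a"
    by (simp add: cong_iff_dvd_diff flip: cong_int_iff)
  then obtain j where "int (a ^ p) - int a = int p * j" ..
  then have "of_int (int (a ^ p) - int a) = (of_nat p * of_int j :: 'a)"
    by simp
  then have X1: "X 1 - X 0 = of_nat p * of_int j"
    by (simp add: X_def)
  have "pabs (of_int j :: 'a) \<le> 1"
    using pabs_of_nat_le[of "nat j"] pabs_of_nat_le[of "nat (- j)"] pabs_minus[of "of_int j"]
    by (cases "j \<ge> 0") auto
  then have X0: "pabs (X 1 - X 0) \<le> 1 / real p"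
    unfolding X1 pabs_mult pabs_p using mult_left_mono[of _ 1 "1 / real p"] by fastforce
  have step: "pabs (X (Suc N) - X N) \<le> (1 / real p) ^ Suc N" for N
  proof (induction N)
    case (Suc N)
    have "(1 / real p) ^ Suc N \<le> (1 / real p) ^ 1"
      using p_ge_3 by (intro power_decreasing) auto
    then have "pabs (X (Suc (Suc N)) - X (Suc N)) \<le> pabs (X (Suc N) - X N) / real p"
      unfolding X_Suc[of "Suc N"] X_Suc[of N]
      using Suc pabs_pth_power_diff_le[of "X N ^ p" "X N"] X_le[of N] X_le[of "Suc N"] by (simp add: X_Suc)
    also have "\<dots> \<le> (1 / real p) ^ Suc N / real p"
      using Suc by (intro divide_right_mono) auto
    finally show ?case by simp
  qed (use X0 in simp)
  have "(\<lambda>N. X (Suc N) - X N) \<longlonglongrightarrow> 0"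
  proof (rule tendsto_pabs_bound)
    show "pabs (X (Suc N) - X N - 0) \<le> (1 / real p) ^ Suc N" for N
      using step by simp
    show "(\<lambda>N. (1 / real p) ^ Suc N) \<longlonglongrightarrow> 0"
      using p_ge_3 by (intro LIMSEQ_Suc LIMSEQ_power_zero) simp
  qed
  then obtain z where z: "X \<longlonglongrightarrow> z"
    using convergent_of_differences by (auto simp: convergent_def)
  have "pabs (X N - of_nat a) \<le> 1 / real p" for N
  proof (induction N)
    case (Suc N)
    have "(1 / real p) ^ Suc N \<le> (1 / real p) ^ 1"
      using p_ge_3 by (intro power_decreasing) auto
    then show ?case
      using Suc step[of N] pabs_diff_triangle[of "X (Suc N)" "of_nat a" "X N"] by simp
  qed (simp add: X_def)
  then have za: "pabs (z - of_nat a) \<le> 1 / real p"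
    using pabs_tendsto_le[OF z] by blast
  have "(\<lambda>N. X (Suc N)) \<longlonglongrightarrow> z ^ p"
    unfolding X_Suc by (rule tendsto_padic_power[OF z])
  then have "z ^ p = z"
    using LIMSEQ_Suc[OF z] LIMSEQ_unique by blast
  moreover have "z \<noteq> 0"
  proof
    assume "z = 0"
    then have "pabs (of_nat a :: 'a) < 1"
      using za p_ge_3 by (simp add: le_less_trans)
    then show False
      using pabs_of_nat_eq_1[OF assms] by simp
  qed
  ultimately have "z ^ (p - 1) = 1"
    by (metis mult_cancel_right2 p_pos power_minus_mult)
  then show ?thesis
    using that za by blast
qed

lemma teichmueller:
  assumes "\<not> p dvd a"
  shows teichmueller_power: "(teichmueller p a :: 'a) ^ (p - 1) = 1"
    and pabs_teichmueller_diff: "pabs (teichmueller p a - of_nat a :: 'a) \<le> 1 / real p"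
proof -
  obtain z :: 'a where z: "z ^ (p - 1) = 1" "pabs (z - of_nat a) \<le> 1 / real p"
    using teichmueller_exists[OF assms] by blast
  then have z': "pabs (z - of_nat a) < 1"
    using p_ge_3 by (simp add: le_less_trans)
  have "(teichmueller p a :: 'a) = (THE z. z ^ (p - 1) = 1 \<and> pabs (z - of_nat a) < 1)"
    using assms by (simp add: teichmueller_def)
  also have "\<dots> = z"
    using z z' teichmueller_unique[OF assms] by (intro the_equality) auto
  finally show "(teichmueller p a :: 'a) ^ (p - 1) = 1" "pabs (teichmueller p a - of_nat a :: 'a) \<le> 1 / real p"
    using z by auto
qed

lemma teichmueller_eqI:
  assumes "\<not> p dvd a" "(z::'a) ^ (p - 1) = 1" "pabs (z - of_nat a) < 1"
  shows "teichmueller p a = z"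
proof (rule teichmueller_unique[OF assms(1) _ _ assms(2,3)])
  show "pabs (teichmueller p a - of_nat a :: 'a) < 1"
    using pabs_teichmueller_diff[OF assms(1)] p_ge_3 by (simp add: le_less_trans)
qed (rule teichmueller_power[OF assms(1)])

lemma pabs_teichmueller_diff_less:
  assumes "\<not> p dvd a"
  shows "pabs (teichmueller p a - of_nat a :: 'a) < 1"
  using pabs_teichmueller_diff[OF assms] p_ge_3 by (simp add: le_less_trans)

lemma pabs_teichmueller:
  assumes "\<not> p dvd a"
  shows "pabs (teichmueller p a :: 'a) = 1"
  using pabs_add_eq_left[of "teichmueller p a - of_nat a" "of_nat a"]
    pabs_teichmueller_diff_less[OF assms] pabs_of_nat_eq_1[OF assms] by simp

lemma coprime_p_iff: "coprime a p \<longleftrightarrow> \<not> p dvd a"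
  using prime_p by (metis coprime_commute coprime_absorb_left not_prime_unit prime_imp_coprime)

text \<open>Periodicity and multiplicativity reduce to uniqueness: the proposed value is again a
  (p-1)-th root of unity in the required residue disc.\<close>

lemma dirichlet_char_teichmueller: "dirichlet_char p (teichmueller p :: nat \<Rightarrow> 'a)"
  unfolding dirichlet_char_def
proof (intro conjI allI)
  note lt1 = pabs_teichmueller_diff_less
  show "p > 0" by simp
  have "\<not> p dvd 1"
    using prime_p not_prime_unit by blast
  then show "teichmueller p 1 = (1::'a)"
    by (intro teichmueller_eqI) auto
  fix a
  show "(teichmueller p a = (0::'a)) = (\<not> coprime a p)"
    using pabs_teichmueller[of a] by (cases "p dvd a") (auto simp: coprime_p_iff teichmueller_def)
  show "teichmueller p (a + p) = (teichmueller p a :: 'a)"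
  proof (cases "p dvd a")
    case False
    have "pabs (teichmueller p a - of_nat a - of_nat p :: 'a) < 1"
      by (rule pabs_diff_lessI) (use lt1[OF False] p_ge_3 in \<open>simp_all add: pabs_p\<close>)
    then have "pabs (teichmueller p a - of_nat (a + p) :: 'a) < 1"
      by (simp add: diff_diff_eq)
    then show ?thesis
      using False by (intro teichmueller_eqI teichmueller_power) auto
  qed (simp add: teichmueller_def)
  fix b
  show "teichmueller p (a * b) = teichmueller p a * (teichmueller p b :: 'a)"
  proof (cases "p dvd a * b")
    case True
    then show ?thesis
      using prime_dvd_mult_iff[OF prime_p] by (auto simp: teichmueller_def)
  next
    case False
    then have ab: "\<not> p dvd a" "\<not> p dvd b"
      by auto
    let ?a = "teichmueller p a :: 'a" and ?b = "teichmueller p b :: 'a"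
    have "?a * ?b - of_nat (a * b) = ?a * (?b - of_nat b) + (?a - of_nat a) * of_nat b"
      by (simp add: algebra_simps)
    moreover have "pabs (?a * (?b - of_nat b)) < 1"
      using lt1[OF ab(2)] pabs_teichmueller[OF ab(1)] by (simp add: pabs_mult)
    moreover have "pabs ((?a - of_nat a) * of_nat b) < 1"
      using lt1[OF ab(1)] pabs_of_nat_eq_1[OF ab(2)] by (simp add: pabs_mult)
    ultimately have lt: "pabs (?a * ?b - of_nat (a * b)) < 1"
      using le_less_trans[OF pabs_add_le] by (metis max_less_iff_conj)
    then show ?thesis
      by (intro teichmueller_eqI[OF False _ lt])
        (simp only: power_mult_distrib teichmueller_power ab not_False_eq_True mult_1_right)
  qed
qed

end

section \<open>The Riemann sums\<close>

lemma sum_multiples: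
  fixes f :: "nat \<Rightarrow> 'b::comm_monoid_add"
  assumes "p > 0" and "\<And>a. \<not> p dvd a \<Longrightarrow> f a = 0"
  shows "(\<Sum>a<p * K. f a) = (\<Sum>b<K. f (p * b))"
proof -
  have "(\<Sum>a<p * K. f a) = sum f ((*) p ` {..<K})"
  proof (rule sum.mono_neutral_right)
    show "\<forall>a\<in>{..<p * K} - (*) p ` {..<K}. f a = 0"
    proof
      fix a assume a: "a \<in> {..<p * K} - (*) p ` {..<K}"
      have "\<not> p dvd a"
      proof
        assume "p dvd a"
        then obtain b where "a = p * b" ..
        then show False
          using a by auto
      qed
      then show "f a = 0"
        by (rule assms(2))
    qed
  qed (use assms(1) in auto)
  also have "\<dots> = (\<Sum>b<K. f (p * b))"
    using assms(1) by (subst sum.reindex) (auto simp: inj_on_def)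
  finally show ?thesis .
qed

text \<open>This is [pb]_q = [p]_q [b]_(q^p) for q-numbers written as geometric sums.\<close>

lemma geometric_sum_mult:
  fixes q :: "'b::comm_semiring_1"
  shows "(\<Sum>i<p * b. q ^ i) = (\<Sum>i<p. q ^ i) * (\<Sum>j<b. (q ^ p) ^ j)"
proof (induction b)
  case (Suc b)
  have "(\<Sum>i<m + k. q ^ i) = (\<Sum>i<m. q ^ i) + (\<Sum>i<k. q ^ (m + i))" for m k
    by (induction k) (simp_all add: add.assoc)
  from this[of "p * b" p] have "(\<Sum>i<p * Suc b. q ^ i) = (\<Sum>i<p * b. q ^ i) + (\<Sum>i<p. q ^ (p * b + i))"
    by (simp add: add.commute)
  also have "(\<Sum>i<p. q ^ (p * b + i)) = (\<Sum>i<p. q ^ i) * (q ^ p) ^ b"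
    by (simp add: power_add sum_distrib_right mult.commute flip: power_mult)
  finally show ?case
    by (simp add: Suc distrib_left)
qed simp

context padic_complex
begin

section \<open>Values of the integrands at natural numbers\<close>

lemma X_nat_in_X_star_iff:
  assumes "d > 0"
  shows "X_nat d p a \<in> X_star d p \<longleftrightarrow> \<not> p dvd a"
proof -
  have X: "X_nat d p a \<in> X_space d p"
    using assms by (intro X_nat_in_X_space) auto
  have dvd: "p dvd a mod (d * p) \<longleftrightarrow> p dvd a"
    by (simp add: dvd_mod_iff)
  show ?thesis
  proof
    assume "X_nat d p a \<in> X_star d p"
    then obtain b where "b < d * p" "coprime b p" "a mod (d * p) = b"
      by (auto simp: X_star_def X_ball_def X_nat_def)
    then show "\<not> p dvd a"
      using dvd by (simp add: coprime_p_iff)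
  next
    assume "\<not> p dvd a"
    then have "\<not> p dvd a mod (d * p)"
      using dvd by blast
    then have "a mod (d * p) \<noteq> 0" "coprime (a mod (d * p)) p"
      unfolding coprime_p_iff by (metis dvd_0_right, blast)
    then show "X_nat d p a \<in> X_star d p"
      using X assms by (auto simp: X_star_def X_ball_def X_nat_def intro!: bexI[of _ "a mod (d * p)"])
  qed
qed

lemma X_char_X_nat:
  assumes "dirichlet_char m f" and "m dvd d * p"
  shows "X_char f (X_nat d p a) = f a"
  using dirichlet_char_mod[OF assms] by (simp add: X_char_def X_nat_def)

lemma qpow_of_int:
  assumes "pabs ((q::'a) - 1) < rho"
  shows "qpow p q (of_int k) = q powi k"
  unfolding qpow_def by (rule exp_of_int_mult_iwasawa_log[OF assms])

text \<open>The geometric sum absorbs the convention for \<open>qnum\<close> at q = 1, so no later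
  argument has to treat that case separately.\<close>

lemma qnum_of_nat:
  assumes "pabs ((q::'a) - 1) < rho"
  shows "qnum p q (of_nat a) = (\<Sum>i<a. q ^ i)"
proof (cases "q = 1")
  case False
  then show ?thesis
    using qpow_of_int[OF assms, of "int a"] by (simp add: qnum_def sum_gp_strict)
qed (simp add: qnum_def)

lemma pabs_qnum_minus_le:
  assumes "pabs ((q::'a) - 1) < rho"
  shows "pabs (qnum p q (of_nat a) - of_nat a) \<le> pabs (q - 1)"
proof -
  have "qnum p q (of_nat a) - of_nat a = (\<Sum>i<a. q ^ i - 1)"
    by (simp add: qnum_of_nat[OF assms] sum_subtractf)
  also have "pabs \<dots> \<le> pabs (q - 1)"
    using assms rho_less_1 by (intro pabs_sum_le pabs_power_minus_1_le) auto
  finally show ?thesis .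
qed

lemma char_teichmueller_X_nat: "X_char (teichmueller p) (X_nat d p a) = (teichmueller p a :: 'a)"
  by (rule X_char_X_nat[OF dirichlet_char_teichmueller]) simp

text \<open>As |\<omega>(a)| = 1, the distances of [a]_q and \<omega>(a) from a control u - 1, and
  the exponential inverts the logarithm at u. The exponent is +n because \<open>l_integrand\<close>
  negates its argument s = -n.\<close>

lemma qangle_pow_of_nat:
  assumes q: "pabs ((q::'a) - 1) < rho" and "d > 0" and a: "\<not> p dvd a"
  shows "qangle_pow p q (X_nat d p a) (of_nat n) = qnum p q (of_nat a) ^ n * teichmueller p a powi (- int n)"
proof -
  define u where "u = qnum p q (of_nat a) / teichmueller p a"
  have w: "pabs (teichmueller p a :: 'a) = 1"
    using a by (rule pabs_teichmueller)
  then have w0: "(teichmueller p a :: 'a) \<noteq> 0"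
    by (metis pabs_0 zero_neq_one)
  have "pabs ((qnum p q (of_nat a) - of_nat a) - (teichmueller p a - of_nat a)) < rho"
    using le_less_trans[OF pabs_qnum_minus_le[OF q, of a] q]
      le_less_trans[OF pabs_teichmueller_diff[OF a] rho_gt] by (rule pabs_diff_lessI)
  then have "pabs (qnum p q (of_nat a) - teichmueller p a) < rho"
    by simp
  moreover have "u - 1 = (qnum p q (of_nat a) - teichmueller p a) / teichmueller p a"
    using w0 by (simp add: u_def field_simps)
  ultimately have "pabs (u - 1) < rho"
    by (simp add: pabs_divide w)
  then have "padic_exp (of_int (int n) * iwasawa_log p u) = u powi int n"
    by (rule exp_of_int_mult_iwasawa_log)
  then have "padic_exp (of_nat n * iwasawa_log p u) = u ^ n"
    by simp
  moreover have "p > 1"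
    using p_ge_3 by simp
  then have "qangle p q (X_nat d p a) = u"
    by (simp add: qangle_def u_def X_padic_X_nat \<open>d > 0\<close> char_teichmueller_X_nat)
  ultimately show ?thesis
    by (simp add: qangle_pow_def u_def power_int_minus divide_inverse power_mult_distrib power_inverse)
qed

text \<open>That \<open>m\<close> divides \<open>d * p\<close> lets \<open>X_char\<close> read the
  twisted character from the residue modulo \<open>d * p\<close>. The last claim goes beyond the
  definition, which prescribes values only at integers prime to \<open>d * p\<close>: at an integer
  prime to p but not to \<open>d\<close>, both sides vanish.\<close>

lemma char_twist:
  assumes chi: "primitive_char d (chi :: nat \<Rightarrow> 'a)"
  obtains m where "dirichlet_char m (char_twist p d chi n)" and "m dvd d * p"
    and "\<And>a. \<not> p dvd a \<Longrightarrow> char_twist p d chi n a = chi a * teichmueller p a powi (- n)"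
proof -
  have chi': "dirichlet_char d chi"
    using chi by (simp add: primitive_char_def)
  define \<tau> where "\<tau> k a = (if coprime a p then (teichmueller p a :: 'a) powi k else 0)" for k a
  have \<tau>: "dirichlet_char p (\<tau> k)" for k
    unfolding \<tau>_def by (rule dirichlet_char_powi[OF dirichlet_char_teichmueller])
  have dp: "d * p > 0"
    using dirichlet_char_modulus_pos[OF chi'] by simp
  have phi: "dirichlet_char (d * p) (\<lambda>a. chi a * \<tau> (- n) a)"
    by (rule dirichlet_char_times[OF chi' \<tau>])
  obtain m g where g: "primitive_char m g"
    and agree: "\<And>a. coprime a (d * p) \<Longrightarrow> g a = chi a * \<tau> (- n) a"
    using primitive_char_exists[OF phi] by blast
  have g': "dirichlet_char m g"
    using g by (simp add: primitive_char_def)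
  have "char_twist p d chi n = g"
    unfolding char_twist_def
  proof (rule the_equality)
    show "(\<exists>m. primitive_char m g) \<and> (\<forall>a. coprime a (d * p) \<longrightarrow> g a = chi a * teichmueller p a powi (- n))"
      using g agree by (auto simp: \<tau>_def)
  next
    fix f
    assume "(\<exists>m. primitive_char m f) \<and> (\<forall>a. coprime a (d * p) \<longrightarrow> f a = chi a * teichmueller p a powi (- n))"
    then obtain k where f: "primitive_char k f"
      and fa: "\<And>a. coprime a (d * p) \<Longrightarrow> f a = chi a * teichmueller p a powi (- n)"
      by blast
    show "f = g"
      by (rule primitive_char_unique[OF f g dp]) (simp add: fa agree \<tau>_def)
  qed
  moreover have "m dvd d * p"
    using primitive_char_modulus_dvd[OF g phi dp agree] .
  \<comment> \<open>Conversely, \<open>chi\<close> is the primitive character of the product of \<open>g\<close> and the \<open>n\<close>-th power of the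
    Teichmueller character, so each prime divisor of \<open>d\<close> other than \<open>p\<close> divides \<open>m\<close>.\<close>
  moreover have "d dvd m * p"
  proof (rule primitive_char_modulus_dvd[OF chi dirichlet_char_times[OF g' \<tau>[of n]] dp])
    fix a assume a: "coprime a (d * p)"
    then have cp: "coprime a p"
      by simp
    then have "(teichmueller p a :: 'a) \<noteq> 0"
      using pabs_teichmueller[of a] by (auto simp: coprime_p_iff)
    then show "chi a = g a * \<tau> n a"
      using agree[OF a] cp by (simp add: \<tau>_def power_int_minus)
  qed
  have "g a = chi a * teichmueller p a powi (- n)" if a: "\<not> p dvd a" for a
  proof (cases "coprime a d")
    case True
    then show ?thesis
      using agree[of a] a by (simp add: \<tau>_def coprime_p_iff)
  next
    case False
    then have "gcd a d \<noteq> 1"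
      by (simp only: coprime_iff_gcd_eq_1 not_False_eq_True)
    then obtain l where l: "prime l" "l dvd a" "l dvd d"
      using prime_factor_nat by (auto simp del: gcd_greatest_iff dest!: gcd_nat.boundedE)
    have "l \<noteq> p"
      using l a by auto
    then have "\<not> l dvd p"
      using l prime_p primes_dvd_imp_eq by blast
    moreover have "l dvd m * p"
      using l \<open>d dvd m * p\<close> dvd_trans by blast
    ultimately have "l dvd m"
      using l prime_dvd_mult_iff by blast
    then have "\<not> coprime a m"
      using l by (meson coprime_common_divisor not_prime_unit)
    then show ?thesis
      using False dirichlet_char_eq_0_iff[OF g', of a] dirichlet_char_eq_0_iff[OF chi', of a] by simp
  qed
  ultimately show ?thesis
    using that g' by metis
qed

lemma euler_integrand_X_nat:
  assumes q: "pabs ((q::'a) - 1) < rho" and "d > 0"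
    and psi: "dirichlet_char m \<psi>" "m dvd d * p"
  shows "euler_integrand p h n q w \<psi> (X_nat d p a)
    = \<psi> a * q powi ((h - 1) * int a) * w ^ a * (\<Sum>i<a. q ^ i) ^ n"
proof -
  have "p > 1"
    using p_ge_3 by simp
  have "of_int (h - 1) * of_nat a = (of_int ((h - 1) * int a) :: 'a)"
    by simp
  then have "qpow p q (of_int (h - 1) * of_nat a) = q powi ((h - 1) * int a)"
    using qpow_of_int[OF q] by metis
  then show ?thesis
    unfolding euler_integrand_def X_char_X_nat[OF psi] X_padic_X_nat[OF \<open>d > 0\<close> \<open>p > 1\<close>]
      X_pow_X_nat[OF \<open>d > 0\<close> \<open>p > 1\<close>] qnum_of_nat[OF q] by simp
qed

lemma l_integrand_X_nat:
  assumes q: "pabs ((q::'a) - 1) < rho" and chi: "primitive_char d (chi :: nat \<Rightarrow> 'a)"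
  shows "l_integrand p d h q \<xi> (- of_nat n) chi (X_nat d p a)
    = (if p dvd a then 0 else euler_integrand p h n q \<xi> (char_twist p d chi (int n)) (X_nat d p a))"
proof -
  have chi': "dirichlet_char d chi"
    using chi by (simp add: primitive_char_def)
  then have d: "d > 0"
    by (rule dirichlet_char_modulus_pos)
  have p: "p > 1"
    using p_ge_3 by simp
  obtain m where m: "dirichlet_char m (char_twist p d chi (int n))" "m dvd d * p"
    and tw: "\<And>a. \<not> p dvd a \<Longrightarrow> char_twist p d chi (int n) a = chi a * teichmueller p a powi (- int n)"
    using char_twist[OF chi] by blast
  show ?thesis
  proof (cases "p dvd a")
    case True
    then show ?thesis
      by (simp add: l_integrand_def restrict_X_star_def X_nat_in_X_star_iff[OF d])
  next
    case False
    have "X_char chi (X_nat d p a) = chi a"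
      by (rule X_char_X_nat[OF chi']) simp
    then show ?thesis
      using False qangle_pow_of_nat[OF q d False, of n]
      by (simp add: l_integrand_def restrict_X_star_def X_nat_in_X_star_iff[OF d] euler_integrand_def
          X_char_X_nat[OF m] tw X_padic_X_nat[OF d p] mult_ac)
  qed
qed

lemma euler_term_mult_p:
  assumes q: "pabs ((q::'a) - 1) < rho" and "d > 0"
    and psi: "dirichlet_char m \<psi>" "m dvd d * p"
  shows "euler_integrand p h n q w \<psi> (X_nat d p (p * b)) * (- q) ^ (p * b)
    = \<psi> p * qnum p q (of_nat p) ^ n * (euler_integrand p h n (q ^ p) (w ^ p) \<psi> (X_nat d p b) * (- (q ^ p)) ^ b)"
proof -
  have qp: "pabs (q ^ p - 1) < rho"
    using q rho_less_1 by (intro pabs_power_minus_1_less) auto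
  have "q powi ((h - 1) * int (p * b)) = q powi (int p * ((h - 1) * int b))"
    by (simp add: mult_ac)
  also have "\<dots> = (q ^ p) powi ((h - 1) * int b)"
    by (simp only: power_int_mult power_int_of_nat)
  finally have powi: "q powi ((h - 1) * int (p * b)) = (q ^ p) powi ((h - 1) * int b)" .
  have pow: "(- q) ^ (p * b) = (- (q ^ p)) ^ b" "w ^ (p * b) = (w ^ p) ^ b"
    using odd_p by (simp_all add: power_mult)
  show ?thesis
    unfolding euler_integrand_X_nat[OF q \<open>d > 0\<close> psi] euler_integrand_X_nat[OF qp \<open>d > 0\<close> psi]
      qnum_of_nat[OF q] geometric_sum_mult dirichlet_char_mult[OF psi(1)]
      powi pow power_mult_distrib
    by (simp only: mult_ac)
qed

text \<open>The level drops by one because the multiples of p below d p^(N+1) are p b with b < d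
  p^N. The constant (1 + q)/(1 + q^p) is the ratio of the two normalisations, whose numerators 1 -
  (-q)^(pK) and 1 - (-(q^p))^K coincide.\<close>

lemma fermionic_sum_l_integrand:
  fixes q :: 'a
  assumes q: "pabs (q - 1) < rho" and chi: "primitive_char d chi"
    and \<psi>: "\<psi> = char_twist p d chi (int n)"
  shows "fermionic_sum d p q (l_integrand p d h q \<xi> (- of_nat n) chi) (Suc N)
    = fermionic_sum d p q (euler_integrand p h n q \<xi> \<psi>) (Suc N)
      - \<psi> p * qnum p q (of_nat p) ^ n * ((1 + q) / (1 + q ^ p))
        * fermionic_sum d p (q ^ p) (euler_integrand p h n (q ^ p) (\<xi> ^ p) \<psi>) N"
proof -
  have d: "d > 0"
    using chi dirichlet_char_modulus_pos by (auto simp: primitive_char_def)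
  obtain m where m: "dirichlet_char m \<psi>" "m dvd d * p"
    using char_twist[OF chi] unfolding \<psi> by blast
  define E where "E a = euler_integrand p h n q \<xi> \<psi> (X_nat d p a) * (- q) ^ a" for a
  define E' where "E' b = euler_integrand p h n (q ^ p) (\<xi> ^ p) \<psi> (X_nat d p b) * (- (q ^ p)) ^ b" for b
  define L where "L a = l_integrand p d h q \<xi> (- of_nat n) chi (X_nat d p a) * (- q) ^ a" for a
  define K where "K = d * p ^ N"
  have K: "d * p ^ Suc N = p * K"
    by (simp add: K_def)
  have L: "L a = (if p dvd a then 0 else E a)" for a
    unfolding L_def E_def \<psi> l_integrand_X_nat[OF q chi] by simp
  have "(\<Sum>a<p * K. E a) - (\<Sum>a<p * K. L a) = (\<Sum>a<p * K. E a - L a)"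
    by (simp add: sum_subtractf)
  also have "\<dots> = (\<Sum>b<K. E (p * b) - L (p * b))"
    by (rule sum_multiples) (simp_all add: L)
  also have "\<dots> = \<psi> p * qnum p q (of_nat p) ^ n * (\<Sum>b<K. E' b)"
    unfolding sum_distrib_left using euler_term_mult_p[OF q d m] by (simp add: L E_def E'_def)
  finally have sums: "(\<Sum>a<p * K. L a) = (\<Sum>a<p * K. E a) - \<psi> p * qnum p q (of_nat p) ^ n * (\<Sum>b<K. E' b)"
    by (simp add: algebra_simps)
  \<comment> \<open>Since p is odd, 2 is a unit, so 1 + q^p = 2 + (q^p - 1) has absolute value 1.
    Its being nonzero permits the cancellation in \<open>factor\<close>.\<close>
  have "pabs (q ^ p - 1) < 1"
    using q rho_less_1 by (intro pabs_power_minus_1_less) auto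
  moreover have "\<not> p dvd 2"
    using p_ge_3 by (auto dest: dvd_imp_le)
  then have "pabs (2 :: 'a) = 1"
    using pabs_of_nat_eq_1[of 2] by simp
  ultimately have "pabs (2 + (q ^ p - 1)) = 1"
    by (subst pabs_add_eq_left) auto
  then have "1 + q ^ p \<noteq> 0"
    by auto
  then have factor: "1 / qnum_neg q (p * K) = (1 + q) / (1 + q ^ p) * (1 / qnum_neg (q ^ p) K)"
    using odd_p by (simp add: qnum_neg_def power_mult)
  show ?thesis
    unfolding fermionic_sum_def K unfolding L_def[symmetric] E_def[symmetric] E'_def[symmetric]
      K_def[symmetric] sums right_diff_distrib factor
    by (simp only: mult_ac)
qed

end

theorem theorem2:
  fixes p d r n :: nat and h :: int
    and q \<xi> :: "'a::{field_char_0,complete_space}" and chi :: "nat \<Rightarrow> 'a"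
  assumes "prime p" and "odd p" and "is_Cp p TYPE('a)"
    and "d > 0" and "odd d"
    and "pabs (1 - q) < real p powr (- 1 / (real p - 1))"
    and "r > 0" and "\<xi> ^ r = 1" and "coprime r (p * d)" and "pabs (1 - \<xi>) \<ge> 1"
    and "primitive_char d chi"
    and "fermionic_integrable d p q (euler_integrand p h n q \<xi> (char_twist p d chi (int n)))"
    and "fermionic_integrable d p (q ^ p)
           (euler_integrand p h n (q ^ p) (\<xi> ^ p) (char_twist p d chi (int n)))"
  shows "fermionic_integrable d p q (l_integrand p d h q \<xi> (- of_nat n) chi) \<and>
    l_function p d h q \<xi> (- of_nat n) chi =
      euler_number p d h n q \<xi> (char_twist p d chi (int n))
      - char_twist p d chi (int n) p * qnum p q (of_nat p) ^ n * ((1 + q) / (1 + q ^ p))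
        * euler_number p d h n (q ^ p) (\<xi> ^ p) (char_twist p d chi (int n))"
proof -
  interpret padic_complex p "TYPE('a)"
    using assms(1-3) by unfold_locales
  define \<psi> where "\<psi> = char_twist p d chi (int n)"
  define c where "c = \<psi> p * qnum p q (of_nat p) ^ n * ((1 + q) / (1 + q ^ p))"
  have q: "pabs (q - 1) < rho"
    using assms(6) pabs_minus_commute[of q 1] by (simp add: rho_def)
  let ?S = "fermionic_sum d p q (euler_integrand p h n q \<xi> \<psi>)"
    and ?S' = "fermionic_sum d p (q ^ p) (euler_integrand p h n (q ^ p) (\<xi> ^ p) \<psi>)"
    and ?L = "fermionic_sum d p q (l_integrand p d h q \<xi> (- of_nat n) chi)"
  have S: "?S \<longlonglongrightarrow> euler_number p d h n q \<xi> \<psi>"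
    using assms(12) unfolding euler_number_def fermionic_integral_def fermionic_integrable_def \<psi>_def
    by (simp add: convergent_LIMSEQ_iff)
  have S': "?S' \<longlonglongrightarrow> euler_number p d h n (q ^ p) (\<xi> ^ p) \<psi>"
    using assms(13) unfolding euler_number_def fermionic_integral_def fermionic_integrable_def \<psi>_def
    by (simp add: convergent_LIMSEQ_iff)
  have "(\<lambda>N. ?S (Suc N) - c * ?S' N) \<longlonglongrightarrow> euler_number p d h n q \<xi> \<psi> - c * euler_number p d h n (q ^ p) (\<xi> ^ p) \<psi>"
    by (intro tendsto_padic_diff tendsto_padic_cmult LIMSEQ_Suc S S')
  also have "(\<lambda>N. ?S (Suc N) - c * ?S' N) = (\<lambda>N. ?L (Suc N))"
    using fermionic_sum_l_integrand[OF q assms(11) \<psi>_def] by (simp add: c_def)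
  \<comment> \<open>Shifting the index changes neither convergence nor limit, so integrability of
    the l-integrand comes out together with the value of its integral.\<close>
  finally have "?L \<longlonglongrightarrow> euler_number p d h n q \<xi> \<psi> - c * euler_number p d h n (q ^ p) (\<xi> ^ p) \<psi>"
    by (rule LIMSEQ_imp_Suc)
  then show ?thesis
    unfolding l_function_def fermionic_integral_def fermionic_integrable_def c_def \<psi>_def
    by (auto simp: convergent_def dest: limI)
qed

end
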